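(* Let $(g,\Gamma)$ be a complete Gårding-Dirichlet operator on $S(n)$, let $X\subset\mathbb{R}^n$ be open and connected and let $f\in C(X)$. Consider either of the two equations on $X$: (Classical) $g(D^2u)=e^f$ with $D^2u\in\overline\Gamma$, or (Quasi) $g(D^2u+I)=e^f$ with $D^2u+I\in\overline\Gamma$. Let $u,H\in C^2(X)$ be respectively a subsolution and a solution of one of these equations. If $u-H$ has a maximum point in $X$, then $$u=H+c\quad\text{for some constant }c\in\mathbb{R}.$$ Hence the subsolution $u$ must in fact be a solution. In particular, if $H_1,H_2\in C^2(X)$ are two solutions on $X$ with $H_1-H_2$ having either a maximum or a minimum on $X$, then they differ by a constant.
   Context: $S(n)$ is the space of real symmetric $n\times n$ matrices. A Gårding-Dirichlet polynomial (operator) of degree $N\ge1$ is a homogeneous real polynomial $g$ of degree $N$ on $S(n)$ such that $g(I)>0$, $t\mapsto g(tI+A)$ has all real roots for every $A\in S(n)$, and the Gårding cone $\Gamma$, i.e. the connected component of $\{g\ne0\}$ containing $I$ (an open convex cone), satisfies $\{A\ge0\}\subset\overline\Gamma$. The same definition applies with $\mathbb{R}^n$ replaced by any finite-dimensional inner product space $V$ and $S(n)$ by the space $\mathrm{Sym}^2(V)$ of quadratic forms on $V$. The pair $(g,\Gamma)$ is complete if there is no proper linear subspace $V\subset\mathbb{R}^n$ and Gårding-Dirichlet polynomial $h$ on $\mathrm{Sym}^2(V)$ with $g(A)=h(A|_V)$ for all $A\in S(n)$, where $A|_V$ is the restriction of the quadratic form $A$ to $V$. A $C^2$ subsolution of the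 Classical equation is $u\in C^2(X)$ with $D^2u\in\overline\Gamma$ and $g(D^2u)\ge e^f$ on $X$. A $C^2$ subsolution of the Quasi equation is $u\in C^2(X)$ with $D^2u+I\in\overline\Gamma$ and $g(D^2u+I)\ge e^f$ on $X$. Solutions satisfy the corresponding equality. *)

theory Defs
  imports "HOL-Analysis.Analysis" "HOL-Computational_Algebra.Polynomial"
begin

text \<open>
  A quadratic form on a linear subspace V of R^n is encoded by the symmetric matrix representing
  it on V and vanishing on the orthogonal complement of V. This turns the space of quadratic forms
  on V into a linear subspace of the n by n matrices; for V = R^n it is the space S(n).
\<close>

definition Sym2 :: "(real^'n) set \<Rightarrow> (real^'n^'n) set" where
  "Sym2 V = {A. transpose A = A \<and> (\<forall>x \<in> orthogonal_comp V. A *v x = 0)}"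

definition quad_form :: "real^'n^'n \<Rightarrow> real^'n \<Rightarrow> real" where
  "quad_form A x = x \<bullet> (A *v x)"

text \<open>
  The restriction of the quadratic form of A to V; it exists and is unique by the lemma
  \<open>ex1_form_restr\<close> below. The quadratic form |x|^2 of V, which plays the role of the
  identity, is \<open>form_restr V (mat 1)\<close>.
\<close>

definition form_restr :: "(real^'n) set \<Rightarrow> real^'n^'n \<Rightarrow> real^'n^'n" where
  "form_restr V A = (THE B. B \<in> Sym2 V \<and> (\<forall>x\<in>V. quad_form B x = quad_form A x))"

lemma Sym2_UNIV: "Sym2 UNIV = {A. transpose A = A}"
proof -
  have "x = 0" if "x \<in> orthogonal_comp UNIV" for x :: "real^'n"
    using that by (metis (mono_tags, lifting) UNIV_I mem_Collect_eq orthogonal_comp_def orthogonal_self)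
  then show ?thesis by (auto simp: Sym2_def)
qed

lemma symmetric_inner:
  assumes "transpose A = A"
  shows "(A *v x) \<bullet> y = x \<bullet> (A *v (y::real^'n))"
  by (metis assms dot_lmul_matrix vector_transpose_matrix)

lemma Sym2_polarization:
  fixes B :: "real^'n^'n"
  assumes V: "subspace V" and B: "transpose B = B"
    and 0: "\<And>x. x \<in> V \<Longrightarrow> quad_form B x = 0" and xy: "x \<in> V" "y \<in> V"
  shows "x \<bullet> (B *v y) = 0"
proof -
  have "quad_form B (x + y) = quad_form B x + quad_form B y + 2 * (x \<bullet> (B *v y))"
    using symmetric_inner[OF B, of x y]
    by (simp add: quad_form_def matrix_vector_right_distrib inner_add_left inner_add_right
        inner_commute algebra_simps)
  then show ?thesis using 0 xy V by (simp add: subspace_add)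
qed

lemma ex1_form_restr:
  fixes A :: "real^'n^'n"
  assumes V: "subspace V" and A: "transpose A = A"
  shows "\<exists>!B. B \<in> Sym2 V \<and> (\<forall>x\<in>V. quad_form B x = quad_form A x)"
proof -
  have "\<exists>b w. x = b + w \<and> b \<in> V \<and> w \<in> orthogonal_comp V" for x
    using subspace_sum_orthogonal_comp[OF V] by (metis UNIV_I set_plus_elim)
  then obtain P where P: "\<And>x. P x \<in> V" "\<And>x. x - P x \<in> orthogonal_comp V"
    by (metis add_diff_cancel_left')
  have orth: "v \<bullet> w = 0" if "v \<in> V" "w \<in> orthogonal_comp V" for v w
    using that by (auto simp: orthogonal_comp_def orthogonal_def)
  have W: "subspace (orthogonal_comp V)" by (rule subspace_orthogonal_comp)
  have P_unique: "P x = v" if "v \<in> V" "x - v \<in> orthogonal_comp V" for x v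
  proof -
    have 1: "P x - v \<in> V" using P that V by (simp add: subspace_diff)
    have "(x - v) - (x - P x) \<in> orthogonal_comp V" using P that W by (blast intro: subspace_diff)
    then have "P x - v \<in> orthogonal_comp V" by simp
    from orth[OF 1 this] show ?thesis by simp
  qed
  have linP: "linear P"
  proof (rule linearI)
    fix x y :: "real^'n" and c :: real
    have "x + y - (P x + P y) = (x - P x) + (y - P y)" by simp
    then show "P (x + y) = P x + P y"
      using P V W by (metis P_unique subspace_add)
    have "c *\<^sub>R x - c *\<^sub>R P x = c *\<^sub>R (x - P x)" by (simp add: scaleR_diff_right)
    then show "P (c *\<^sub>R x) = c *\<^sub>R P x"
      using P V W by (metis P_unique subspace_scale)
  qed
  have P_self: "x \<bullet> P y = P x \<bullet> P y" and P_self': "P x \<bullet> y = P x \<bullet> P y" for x y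
    using orth[OF P(1) P(2), of y x] orth[OF P(1) P(2), of x y]
    by (auto simp: inner_diff_right inner_commute)
  define B where "B = matrix (\<lambda>x. P (A *v P x))"
  have lin: "linear (\<lambda>x. P (A *v P x))"
    using linear_compose[OF linear_compose[OF linP matrix_vector_mul_linear] linP]
    by (simp add: o_def)
  have Bv: "B *v x = P (A *v P x)" for x
    unfolding B_def by (rule matrix_works) (simp add: lin linear_matrix_vector_mul_eq)
  have Bxy: "x \<bullet> (B *v y) = P x \<bullet> (A *v P y)" for x y
    unfolding Bv by (metis P_self P_self')
  have "x \<bullet> (transpose B *v y) = x \<bullet> (B *v y)" for x y
  proof -
    have "x \<bullet> (transpose B *v y) = (B *v x) \<bullet> y"
      by (metis dot_lmul_matrix vector_transpose_matrix transpose_transpose)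
    also have "\<dots> = P y \<bullet> (A *v P x)" by (simp add: inner_commute Bxy)
    also have "\<dots> = P x \<bullet> (A *v P y)"
      using symmetric_inner[OF A] by (metis inner_commute)
    finally show ?thesis by (simp add: Bxy)
  qed
  then have "transpose B *v y = B *v y" for y by (metis vector_eq_ldot)
  then have symB: "transpose B = B" by (simp add: matrix_eq)
  have "B *v x = 0" if "x \<in> orthogonal_comp V" for x
    using P_unique[of 0 x] that V by (simp add: Bv subspace_0 linear_0[OF linP])
  then have B: "B \<in> Sym2 V" using symB by (simp add: Sym2_def)
  have "quad_form B x = quad_form A x" if "x \<in> V" for x
    using P_unique[of x x] that W by (simp add: quad_form_def Bxy subspace_0)
  moreover have "C = D"
    if CD: "C \<in> Sym2 V" "D \<in> Sym2 V" and eq: "\<forall>x\<in>V. quad_form C x = quad_form D x" for C D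
  proof -
    define E where "E = C - D"
    have symE: "transpose E = E" using CD
      by (auto simp: E_def Sym2_def transpose_def vec_eq_iff)
    have Ew: "E *v w = 0" if "w \<in> orthogonal_comp V" for w
      using CD that by (simp add: E_def Sym2_def matrix_vector_mult_diff_rdistrib)
    have "quad_form E x = 0" if "x \<in> V" for x
      using eq that by (simp add: E_def quad_form_def matrix_vector_mult_diff_rdistrib inner_diff_right)
    then have VV: "x \<bullet> (E *v y) = 0" if "x \<in> V" "y \<in> V" for x y
      using Sym2_polarization[OF V symE] that by blast
    have "x \<bullet> (E *v y) = 0" for x y
    proof -
      have "E *v y = E *v P y" for y
        using Ew[OF P(2), of y] by (simp add: matrix_vector_mult_diff_distrib)
      then have "x \<bullet> (E *v y) = x \<bullet> (E *v P y)" by metis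
      also have "\<dots> = (E *v x) \<bullet> P y" using symmetric_inner[OF symE] by metis
      also have "\<dots> = (E *v P x) \<bullet> P y" using \<open>\<And>y. E *v y = E *v P y\<close> by metis
      also have "\<dots> = P x \<bullet> (E *v P y)" using symmetric_inner[OF symE] by metis
      finally show ?thesis using VV P by simp
    qed
    then have "E *v y = 0" for y by (metis inner_eq_zero_iff)
    then have "E = 0" by (simp add: matrix_eq)
    then show ?thesis by (simp add: E_def)
  qed
  ultimately show ?thesis using B by metis
qed

lemma form_restr_UNIV:
  assumes "transpose A = A"
  shows "form_restr UNIV A = A"
  unfolding form_restr_def
  by (rule the1_equality[OF ex1_form_restr]) (use assms in \<open>auto simp: Sym2_UNIV\<close>)

text \<open>
  Polynomials on the space of quadratic forms are functions on all matrices of which only the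
  values on \<open>Sym2 V\<close> matter.
\<close>

definition garding_cone :: "(real^'n) set \<Rightarrow> (real^'n^'n \<Rightarrow> real) \<Rightarrow> (real^'n^'n) set" where
  "garding_cone V g = connected_component_set {A \<in> Sym2 V. g A \<noteq> 0} (form_restr V (mat 1))"

definition homogeneous_polynomial_on ::
    "(real^'n^'n) set \<Rightarrow> nat \<Rightarrow> (real^'n^'n \<Rightarrow> real) \<Rightarrow> bool" where
  "homogeneous_polynomial_on S N g \<longleftrightarrow>
     (\<exists>p. real_polynomial_function p \<and> (\<forall>A\<in>S. g A = p A)) \<and>
     (\<forall>A\<in>S. \<forall>t. g (t *\<^sub>R A) = t ^ N * g A)"

text \<open>``All real roots'' means that all complex roots are real.\<close>

definition garding_dirichlet ::
    "(real^'n) set \<Rightarrow> nat \<Rightarrow> (real^'n^'n \<Rightarrow> real) \<Rightarrow> bool" where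
  "garding_dirichlet V N g \<longleftrightarrow>
     1 \<le> N \<and> homogeneous_polynomial_on (Sym2 V) N g \<and>
     g (form_restr V (mat 1)) > 0 \<and>
     (\<forall>A\<in>Sym2 V. \<exists>q :: real poly.
        (\<forall>t. poly q t = g (t *\<^sub>R form_restr V (mat 1) + A)) \<and>
        (\<forall>z :: complex. poly (map_poly of_real q) z = 0 \<longrightarrow> z \<in> \<real>)) \<and>
     {A \<in> Sym2 V. \<forall>x\<in>V. quad_form A x \<ge> 0} \<subseteq> closure (garding_cone V g)"

definition complete_operator :: "(real^'n^'n \<Rightarrow> real) \<Rightarrow> bool" where
  "complete_operator g \<longleftrightarrow>
     \<not> (\<exists>V h M. subspace V \<and> V \<noteq> UNIV \<and> garding_dirichlet V M h \<and>
          (\<forall>A\<in>Sym2 UNIV. g A = h (form_restr V A)))"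

definition gradient :: "(real^'n \<Rightarrow> real) \<Rightarrow> real^'n \<Rightarrow> real^'n" where
  "gradient u x = (\<chi> i. frechet_derivative u (at x) (axis i 1))"

definition hessian :: "(real^'n \<Rightarrow> real) \<Rightarrow> real^'n \<Rightarrow> real^'n^'n" where
  "hessian u x = matrix (frechet_derivative (gradient u) (at x))"

text \<open>Meant for open X, as the derivatives are not relative to X.\<close>

definition C2_on :: "(real^'n) set \<Rightarrow> (real^'n \<Rightarrow> real) \<Rightarrow> bool" where
  "C2_on X u \<longleftrightarrow>
     (\<forall>x\<in>X. u differentiable (at x) \<and> gradient u differentiable (at x)) \<and>
     continuous_on X (hessian u)"

datatype equation_kind = Classical | Quasi

fun hessian_arg :: "equation_kind \<Rightarrow> (real^'n \<Rightarrow> real) \<Rightarrow> real^'n \<Rightarrow> real^'n^'n" where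
  "hessian_arg Classical u x = hessian u x"
| "hessian_arg Quasi u x = hessian u x + mat 1"

definition C2_subsolution :: "equation_kind \<Rightarrow> (real^'n^'n \<Rightarrow> real) \<Rightarrow> (real^'n) set \<Rightarrow>
    (real^'n \<Rightarrow> real) \<Rightarrow> (real^'n \<Rightarrow> real) \<Rightarrow> bool" where
  "C2_subsolution k g X f u \<longleftrightarrow> C2_on X u \<and>
     (\<forall>x\<in>X. hessian_arg k u x \<in> closure (garding_cone UNIV g) \<and>
            g (hessian_arg k u x) \<ge> exp (f x))"

definition C2_solution :: "equation_kind \<Rightarrow> (real^'n^'n \<Rightarrow> real) \<Rightarrow> (real^'n) set \<Rightarrow>
    (real^'n \<Rightarrow> real) \<Rightarrow> (real^'n \<Rightarrow> real) \<Rightarrow> bool" where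
  "C2_solution k g X f u \<longleftrightarrow> C2_on X u \<and>
     (\<forall>x\<in>X. hessian_arg k u x \<in> closure (garding_cone UNIV g) \<and>
            g (hessian_arg k u x) = exp (f x))"

definition has_max_in :: "'a set \<Rightarrow> ('a \<Rightarrow> real) \<Rightarrow> bool" where
  "has_max_in X w \<longleftrightarrow> (\<exists>x0\<in>X. \<forall>x\<in>X. w x \<le> w x0)"

definition has_min_in :: "'a set \<Rightarrow> ('a \<Rightarrow> real) \<Rightarrow> bool" where
  "has_min_in X w \<longleftrightarrow> (\<exists>x0\<in>X. \<forall>x\<in>X. w x0 \<le> w x)"

end

theory Submission
  imports Defs "HOL-Computational_Algebra.Fundamental_Theorem_Algebra"
begin

text \<open>
  Write \<open>A\<close> and \<open>B\<close> for the matrices at which the equation evaluates \<open>g\<close> for the subsolution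
  \<open>u\<close> and the solution \<open>H\<close>, so that \<open>A - B\<close> is the Hessian of \<open>u - H\<close> for either equation, both
  lie in the open cone \<open>\<Gamma>\<close>, and \<open>g A \<ge> g B\<close>. The statement is Hopf's strong maximum principle for
  \<open>u - H\<close>. The usual route linearizes \<open>g\<close> at \<open>B\<close> and uses that the derivative of a complete operator
  is positive definite; here Hopf's barrier is compared with \<open>g\<close> directly, without
  differentiating \<open>g\<close>.

  If \<open>u - H\<close> is not constant, the set where it equals its maximum is touched from outside by a ball
  about some \<open>y\<close> at a single point \<open>x0\<close> (\<open>tangent_ball_at_maximum\<close>). Adding a small multiple of the
  barrier \<open>exp (- \<alpha> |x - y|^2)\<close> to \<open>u - H\<close> produces a maximum at an interior point \<open>x1\<close> close to
  \<open>x0\<close>. There the second derivative test gives \<open>A \<le> B - c T\<close>, where \<open>c > 0\<close> and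
  \<open>T = 2 \<alpha> z z^t - I\<close> with \<open>z = x1 - y\<close>. By monotonicity of \<open>g\<close>,
  \<open>g (B - c T) \<ge> g A \<ge> g B\<close>. On the other hand \<open>\<alpha>\<close> can be chosen beforehand, together with a step
  \<open>s > 0\<close>, such that \<open>g (B + s T) > g B\<close> at all points near \<open>x0\<close>: first \<open>s\<close> small enough for
  \<open>B - s I\<close> to stay in \<open>\<Gamma>\<close>, then \<open>\<alpha>\<close> large. Since the logarithm of \<open>g\<close> is concave on lines in
  \<open>\<Gamma>\<close>, a strict increase forwards forces a strict decrease backwards
  (\<open>strict_decrease_backwards\<close>), which is a contradiction (\<open>no_tangent_ball_at_maximum\<close>).

  Two facts about \<open>g\<close> carry this. The first is Garding's theorem that \<open>g\<close> is real rooted along every line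
  through a point of \<open>\<Gamma>\<close> (\<open>real_rooted_line\<close>). On such a line \<open>g\<close> is a product
  of real linear factors, and monotonicity, concavity and convexity of the cone can be read off. It is proved
  by moving the base point from \<open>I\<close> to the given point and showing that the zeros of a
  complexified polynomial never cross the real axis. The second is that, for a complete operator,
  \<open>g (B + t z z^t)\<close> is unbounded in \<open>t\<close> for each \<open>z \<noteq> 0\<close>
  (\<open>unbounded_in_rank_one_direction\<close>): otherwise \<open>z z^t\<close> lies in the lineality space of
  the closed cone, hence so does every \<open>z v^t + v z^t\<close>, and then \<open>g\<close> only depends on the restriction to
  the hyperplane orthogonal to \<open>z\<close>.
\<close>

section \<open>Polynomials with prescribed location of roots\<close>

lemma complex_poly_eq_if_eq_on_reals:
  fixes q r :: "complex poly"
  assumes "\<And>t::real. poly q (of_real t) = poly r (of_real t)"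
  shows "q = r"
proof (rule ccontr)
  assume "q \<noteq> r"
  then have "finite {z. poly (q - r) z = 0}" by (intro poly_roots_finite) simp
  moreover have "range (of_real :: real \<Rightarrow> complex) \<subseteq> {z. poly (q - r) z = 0}"
    using assms by auto
  moreover have "infinite (range (of_real :: real \<Rightarrow> complex))"
    using finite_imageD[of complex_of_real UNIV] infinite_UNIV_char_0 by (auto simp: inj_def)
  ultimately show False using finite_subset by blast
qed

lemma poly_map_poly_complex_of_real:
  "poly (map_poly of_real q) (complex_of_real t) = of_real (poly q t)"
  by (induction q) (auto simp: map_poly_pCons)

text \<open>
  Normalizing at \<open>0\<close> instead of at infinity gives factors that remain meaningful when the degree
  drops along a family of polynomials; the roots are \<open>- 1 / \<mu> i\<close>.
\<close>

lemma complex_poly_normalized_factors: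
  fixes q :: "complex poly"
  assumes "poly q 0 \<noteq> 0"
  obtains \<mu> where "\<And>i. i < degree q \<Longrightarrow> \<mu> i \<noteq> 0"
    and "\<And>z. poly q z = poly q 0 * (\<Prod>i<degree q. 1 + z * \<mu> i)"
    and "\<And>i. i < degree q \<Longrightarrow> poly q (- 1 / \<mu> i) = 0"
proof -
  obtain r where r: "smult (lead_coeff q) (\<Prod>i<degree q. [:- r i, 1:]) = q"
    using complex_poly_decompose' by blast
  have q: "poly q z = lead_coeff q * (\<Prod>i<degree q. z - r i)" for z
    by (subst r[symmetric]) (simp add: poly_prod algebra_simps del: r)
  have r0: "r i \<noteq> 0" if "i < degree q" for i
    using assms that q[of 0] by auto
  show ?thesis
  proof (rule that[of "\<lambda>i. - 1 / r i"])
    show "- 1 / r i \<noteq> 0" if "i < degree q" for i using r0[OF that] by simp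
    have "(\<Prod>i<degree q. z - r i) = (\<Prod>i<degree q. 0 - r i) * (\<Prod>i<degree q. 1 + z * (- 1 / r i))" for z
      unfolding prod.distrib[symmetric]
      by (rule prod.cong) (auto simp: field_simps r0)
    then show "poly q z = poly q 0 * (\<Prod>i<degree q. 1 + z * (- 1 / r i))" for z
      using q by (metis mult.assoc)
    show "poly q (- 1 / (- 1 / r i)) = 0" if "i < degree q" for i
      using that by (auto simp: q)
  qed
qed

text \<open>
  This bound replaces continuity of roots: if all polynomials of a family of bounded degree have their zeros
  in the upper half plane and values at \<open>0\<close> bounded away from zero, then their limits
  have no zeros in the lower half plane. Each factor is bounded below because \<open>1 / w\<close> and \<open>\<mu> i\<close>
  have positive imaginary parts, so they cannot cancel in \<open>1 / w + \<mu> i\<close>.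
\<close>

lemma norm_poly_lower_bound_upper_half_plane:
  fixes q :: "complex poly"
  assumes q0: "poly q 0 \<noteq> 0" and deg: "degree q \<le> d"
    and roots: "\<And>z. poly q z = 0 \<Longrightarrow> Im z > 0" and w: "Im w < 0"
  shows "norm (poly q w) \<ge> norm (poly q 0) * (\<bar>Im w\<bar> / norm w) ^ d"
proof -
  obtain \<mu> where nz: "\<And>i. i < degree q \<Longrightarrow> \<mu> i \<noteq> 0"
    and fac: "\<And>z. poly q z = poly q 0 * (\<Prod>i<degree q. 1 + z * \<mu> i)"
    and root: "\<And>i. i < degree q \<Longrightarrow> poly q (- 1 / \<mu> i) = 0"
    using complex_poly_normalized_factors[OF q0] by blast
  define c where "c = \<bar>Im w\<bar> / norm w"
  have w0: "w \<noteq> 0" using w by auto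
  have c: "0 \<le> c" "c \<le> 1" using abs_Im_le_cmod[of w] w0 by (auto simp: c_def)
  have "c \<le> norm (1 + w * \<mu> i)" if i: "i < degree q" for i
  proof -
    have "Im (- 1 / \<mu> i) = Im (\<mu> i) / (norm (\<mu> i))\<^sup>2"
      by (simp add: Im_divide cmod_power2)
    then have "Im (\<mu> i) > 0"
      using roots[OF root[OF i]] nz[OF i] by (simp add: zero_less_divide_iff)
    moreover have "Im (1 / w) = \<bar>Im w\<bar> / (norm w)\<^sup>2"
      using w by (simp add: Im_divide cmod_power2)
    ultimately have "\<bar>Im w\<bar> / (norm w)\<^sup>2 \<le> Im (1 / w + \<mu> i)" by simp
    also have "\<dots> \<le> norm (1 / w + \<mu> i)" using abs_Im_le_cmod[of "1 / w + \<mu> i"] by linarith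
    finally have "norm w * (\<bar>Im w\<bar> / (norm w)\<^sup>2) \<le> norm w * norm (1 / w + \<mu> i)"
      by (intro mult_left_mono) auto
    also have "\<dots> = norm (1 + w * \<mu> i)"
      unfolding norm_mult[symmetric] using w0 by (simp add: distrib_left)
    finally show ?thesis using w0 by (simp add: c_def power2_eq_square)
  qed
  then have "(\<Prod>i<degree q. c) \<le> (\<Prod>i<degree q. norm (1 + w * \<mu> i))"
    using c by (intro prod_mono) auto
  moreover have "c ^ d \<le> c ^ degree q" using deg c by (intro power_decreasing) auto
  ultimately have "c ^ d \<le> (\<Prod>i<degree q. norm (1 + w * \<mu> i))" by simp
  then show ?thesis
    unfolding c_def[symmetric] by (subst fac) (simp add: norm_mult prod_norm mult_left_mono)
qed

definition real_rooted :: "real poly \<Rightarrow> bool" where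
  "real_rooted q \<longleftrightarrow> (\<forall>z :: complex. poly (map_poly of_real q) z = 0 \<longrightarrow> z \<in> \<real>)"

lemma real_rooted_normalized_factors:
  assumes "real_rooted q" "poly q 0 \<noteq> 0"
  obtains n and \<mu> :: "nat \<Rightarrow> real" where "\<And>t. poly q t = poly q 0 * (\<Prod>i<n. 1 + t * \<mu> i)"
proof -
  define Q where "Q = map_poly complex_of_real q"
  have Q: "poly Q (of_real t) = of_real (poly q t)" for t
    unfolding Q_def by (rule poly_map_poly_complex_of_real)
  have Q0: "poly Q 0 \<noteq> 0" using Q[of 0] assms(2) by simp
  obtain \<nu> where fac: "\<And>z. poly Q z = poly Q 0 * (\<Prod>i<degree Q. 1 + z * \<nu> i)"
    and root: "\<And>i. i < degree Q \<Longrightarrow> poly Q (- 1 / \<nu> i) = 0"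
    by (rule complex_poly_normalized_factors[OF Q0], rule that)
  have real: "\<nu> i = of_real (Re (\<nu> i))" if "i < degree Q" for i
  proof -
    have "- 1 / \<nu> i \<in> \<real>" using root[OF that] assms(1) by (auto simp: real_rooted_def Q_def)
    then have "inverse (- 1 / \<nu> i) \<in> \<real>" by (rule Reals_inverse)
    then have "\<nu> i \<in> \<real>" by simp
    then show ?thesis by (simp add: of_real_Re)
  qed
  show ?thesis
  proof (rule that[where n = "degree Q" and \<mu> = "\<lambda>i. Re (\<nu> i)"])
    fix t
    have "complex_of_real (poly q t) = of_real (poly q 0) * (\<Prod>i<degree Q. 1 + of_real t * \<nu> i)"
      using fac[of "of_real t"] Q[of t] Q[of 0] by simp
    also have "(\<Prod>i<degree Q. 1 + of_real t * \<nu> i) = (\<Prod>i<degree Q. of_real (1 + t * Re (\<nu> i)))"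
      by (rule prod.cong) (use real in \<open>auto simp: complex_eq_iff\<close>)
    finally show "poly q t = poly q 0 * (\<Prod>i<degree Q. 1 + t * Re (\<nu> i))"
      by (metis of_real_eq_iff of_real_mult of_real_prod)
  qed
qed

lemma normalized_factors_nonneg:
  fixes \<mu> :: "nat \<Rightarrow> real"
  assumes pos: "\<And>t. t \<ge> 0 \<Longrightarrow> c * (\<Prod>i<n. 1 + t * \<mu> i) \<noteq> 0" and i: "i < n"
  shows "\<mu> i \<ge> 0"
proof (rule ccontr)
  assume "\<not> \<mu> i \<ge> 0"
  then have "- 1 / \<mu> i \<ge> 0" "1 + (- 1 / \<mu> i) * \<mu> i = 0" by auto
  then show False using pos[of "- 1 / \<mu> i"] i by (auto simp: prod_zero_iff)
qed

section \<open>Complexification of real polynomials\<close>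

text \<open>
  Pairs \<open>(x, y)\<close> stand for \<open>x + i y\<close> in the complexification of a real vector space, and this is
  the multiplication by complex scalars.
\<close>

definition complex_scale :: "complex \<Rightarrow> 'a \<times> 'a \<Rightarrow> 'a::real_vector \<times> 'a" where
  "complex_scale z a = (Re z *\<^sub>R fst a - Im z *\<^sub>R snd a, Re z *\<^sub>R snd a + Im z *\<^sub>R fst a)"

lemma complex_scale_add_right: "complex_scale z (a + b) = complex_scale z a + complex_scale z b"
  and complex_scale_add_left: "complex_scale (z + w) a = complex_scale z a + complex_scale w a"
  and complex_scale_scale: "complex_scale z (complex_scale w a) = complex_scale (z * w) a"
  and complex_scale_one [simp]: "complex_scale 1 a = a"
  and complex_scale_zero [simp]: "complex_scale 0 a = 0"
  and complex_scale_real: "complex_scale (of_real t) (x, 0) = (t *\<^sub>R x, 0)"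
  by (cases a; simp add: complex_scale_def algebra_simps zero_prod_def)+

lemma continuous_on_complex_scale [continuous_intros]:
  fixes h :: "'b::topological_space \<Rightarrow> 'a::real_normed_vector \<times> 'a"
  assumes "continuous_on T k" "continuous_on T h"
  shows "continuous_on T (\<lambda>x. complex_scale (k x) (h x))"
  unfolding complex_scale_def by (intro continuous_intros assms)

text \<open>
  Only the restriction to complex lines matters later, and there a polynomial is described by a
  univariate one. The degree bound has to be uniform in the line, since the exponent in
  \<open>norm_poly_lower_bound_upper_half_plane\<close> depends on it.
\<close>

lemma polynomial_complexification:
  fixes p :: "'a::real_normed_vector \<Rightarrow> real"
  assumes "real_polynomial_function p"
  obtains G d where "continuous_on UNIV G" "\<And>x. G (x, 0) = complex_of_real (p x)"
    and "\<And>a b. \<exists>q. degree q \<le> d \<and> (\<forall>z. G (a + complex_scale z b) = poly q z)"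
proof -
  have "\<exists>G d. continuous_on UNIV G \<and> (\<forall>x. G (x, 0) = complex_of_real (p x)) \<and>
      (\<forall>a b. \<exists>q. degree q \<le> d \<and> (\<forall>z. G (a + complex_scale z b) = poly q z))"
    using assms
  proof (induction p rule: real_polynomial_function.induct)
    case (linear f)
    interpret bounded_linear f by fact
    define G where "G = (\<lambda>a. Complex (f (fst a)) (f (snd a)))"
    have "continuous_on UNIV G"
      unfolding G_def Complex_eq by (intro continuous_intros continuous_on)
    moreover have "G (a + complex_scale z b) = poly [:G a, G b:] z" for a b z
      by (simp add: G_def complex_scale_def complex_eq_iff add diff scaleR algebra_simps)
    then have "\<exists>q. degree q \<le> 1 \<and> (\<forall>z. G (a + complex_scale z b) = poly q z)" for a b
      by (intro exI[of _ "[:G a, G b:]"]) simp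
    moreover have "G (x, 0) = complex_of_real (f x)" for x
      by (simp add: G_def complex_eq_iff)
    ultimately show ?case by blast
  next
    case (const c)
    have "\<exists>q. degree q \<le> 0 \<and> (\<forall>z. complex_of_real c = poly q z)"
      by (rule exI[of _ "[:of_real c:]"]) simp
    then show ?case
      by (intro exI[of _ "\<lambda>_. of_real c"] exI[of _ "0::nat"]) simp
  next
    case (add f h)
    from add.IH obtain F d H e where F: "continuous_on UNIV F" "\<And>x. F (x, 0) = complex_of_real (f x)"
        "\<And>a b. \<exists>q. degree q \<le> d \<and> (\<forall>z. F (a + complex_scale z b) = poly q z)"
      and H: "continuous_on UNIV H" "\<And>x. H (x, 0) = complex_of_real (h x)"
        "\<And>a b. \<exists>q. degree q \<le> e \<and> (\<forall>z. H (a + complex_scale z b) = poly q z)"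
      by blast
    have "\<exists>q. degree q \<le> max d e \<and> (\<forall>z. F (a + complex_scale z b) + H (a + complex_scale z b) = poly q z)" for a b
      using F(3)[of a b] H(3)[of a b] by (metis degree_add_le_max poly_add max.mono order.trans)
    then show ?case using F H
      by (intro exI[of _ "\<lambda>a. F a + H a"] exI[of _ "max d e"]) (auto intro!: continuous_intros)
  next
    case (mult f h)
    from mult.IH obtain F d H e where F: "continuous_on UNIV F" "\<And>x. F (x, 0) = complex_of_real (f x)"
        "\<And>a b. \<exists>q. degree q \<le> d \<and> (\<forall>z. F (a + complex_scale z b) = poly q z)"
      and H: "continuous_on UNIV H" "\<And>x. H (x, 0) = complex_of_real (h x)"
        "\<And>a b. \<exists>q. degree q \<le> e \<and> (\<forall>z. H (a + complex_scale z b) = poly q z)"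
      by blast
    have "\<exists>q. degree q \<le> d + e \<and> (\<forall>z. F (a + complex_scale z b) * H (a + complex_scale z b) = poly q z)" for a b
      using F(3)[of a b] H(3)[of a b] by (metis degree_mult_le poly_mult add_mono order.trans)
    then show ?case using F H
      by (intro exI[of _ "\<lambda>a. F a * H a"] exI[of _ "d + e"]) (auto intro!: continuous_intros)
  qed
  then show ?thesis using that by blast
qed

lemma real_polynomial_on_line:
  fixes p :: "'a::real_normed_vector \<Rightarrow> real"
  assumes "real_polynomial_function p"
  shows "\<exists>q :: real poly. \<forall>t. p (a + t *\<^sub>R b) = poly q t"
  using assms
proof (induction p rule: real_polynomial_function.induct)
  case (linear f)
  interpret bounded_linear f by fact
  show ?case by (rule exI[of _ "[:f a, f b:]"]) (simp add: add scaleR)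
next
  case (const c)
  show ?case by (rule exI[of _ "[:c:]"]) simp
qed (metis poly_add poly_mult)+

section \<open>Hyperbolic polynomials and the Garding cone\<close>

lemma closed_projection_compact:
  fixes C :: "('a::metric_space \<times> 'b::metric_space) set"
  assumes "compact K" "closed C"
  shows "closed {x. \<exists>k\<in>K. (x, k) \<in> C}"
proof (subst closed_sequential_limits, safe)
  fix xs x
  assume "\<forall>n. xs n \<in> {x. \<exists>k\<in>K. (x, k) \<in> C}" and lim: "xs \<longlonglongrightarrow> x"
  then have "\<forall>n. \<exists>k. k \<in> K \<and> (xs n, k) \<in> C" by auto
  then obtain k :: "nat \<Rightarrow> 'b" where k: "\<And>n. k n \<in> K" "\<And>n. (xs n, k n) \<in> C" by metis
  obtain l and r :: "nat \<Rightarrow> nat" where l: "l \<in> K" and r: "strict_mono r" "(k \<circ> r) \<longlonglongrightarrow> l"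
    using assms(1) k(1) unfolding compact_eq_seq_compact_metric seq_compact_def by metis
  have "(\<lambda>n. (xs (r n), k (r n))) \<longlonglongrightarrow> (x, l)"
    using LIMSEQ_subseq_LIMSEQ[OF lim r(1)] r(2) by (intro tendsto_Pair) (auto simp: o_def)
  then have "(x, l) \<in> C"
    using assms(2)[unfolded closed_sequential_limits, rule_format, of "\<lambda>n. (xs (r n), k (r n))"] k(2)
    by blast
  then show "\<exists>k\<in>K. (x, k) \<in> C" using l by blast
qed

text \<open>
  The subspace \<open>S\<close> is needed because the polynomials of interest live on the symmetric matrices inside
  the space of all matrices.
\<close>

locale hyperbolic_polynomial =
  fixes S :: "'a::real_normed_vector set" and g :: "'a \<Rightarrow> real" and N :: nat and e :: 'a
  assumes subspace: "subspace S"
    and polynomial: "\<exists>p. real_polynomial_function p \<and> (\<forall>A\<in>S. g A = p A)"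
    and homogeneous: "A \<in> S \<Longrightarrow> g (t *\<^sub>R A) = t ^ N * g A"
    and e_in: "e \<in> S" and e_pos: "g e > 0"
    and real_roots: "A \<in> S \<Longrightarrow> \<exists>q. (\<forall>t. poly q t = g (t *\<^sub>R e + A)) \<and> real_rooted q"
begin

definition \<Gamma> :: "'a set" where
  "\<Gamma> = connected_component_set {A \<in> S. g A \<noteq> 0} e"

lemma comb_in [intro]: "A \<in> S \<Longrightarrow> B \<in> S \<Longrightarrow> A + t *\<^sub>R B \<in> S"
  "A \<in> S \<Longrightarrow> B \<in> S \<Longrightarrow> t *\<^sub>R A + B \<in> S"
  using subspace by (auto intro: subspace_add subspace_scale)

lemma line_polynomial:
  assumes "A \<in> S" "B \<in> S"
  shows "\<exists>q :: real poly. \<forall>t. g (A + t *\<^sub>R B) = poly q t"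
proof -
  obtain p where p: "real_polynomial_function p" "\<And>A. A \<in> S \<Longrightarrow> g A = p A"
    using polynomial by auto
  show ?thesis using real_polynomial_on_line[OF p(1), of A B] p(2) comb_in(1)[OF assms] by metis
qed

lemma continuous_on_S: "continuous_on S g"
proof -
  obtain p where p: "real_polynomial_function p" "\<And>A. A \<in> S \<Longrightarrow> g A = p A"
    using polynomial by auto
  have "continuous_on S p"
    using p(1) by (simp add: continuous_on_polymonial_function real_polynomial_function_eq)
  then show ?thesis using p(2) by (simp cong: continuous_on_cong)
qed

lemma factors_in_direction_e:
  assumes "A \<in> S" "g A \<noteq> 0"
  obtains n and \<mu> :: "nat \<Rightarrow> real" where "\<And>t. g (A + t *\<^sub>R e) = g A * (\<Prod>i<n. 1 + t * \<mu> i)"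
proof -
  obtain q where q: "\<And>t. poly q t = g (t *\<^sub>R e + A)" "real_rooted q"
    using real_roots[OF assms(1)] by auto
  have q0: "poly q 0 = g A" using q(1)[of 0] by simp
  then have q0': "poly q 0 \<noteq> 0" using assms(2) by simp
  obtain n and \<mu> :: "nat \<Rightarrow> real" where \<mu>: "\<And>t. poly q t = poly q 0 * (\<Prod>i<n. 1 + t * \<mu> i)"
    using real_rooted_normalized_factors[OF q(2)] q0' by blast
  have "g (A + t *\<^sub>R e) = g A * (\<Prod>i<n. 1 + t * \<mu> i)" for t
    using \<mu>[of t] q(1)[of t] q0 by (simp add: add.commute)
  then show ?thesis by (rule that)
qed

text \<open>
  All factors \<open>1 + t * \<mu> i\<close> have \<open>\<mu> i \<ge> 0\<close>, as there is no root on the half line.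
\<close>

lemma increasing_in_direction_e:
  assumes A: "A \<in> S" and pos: "\<And>t. t \<ge> 0 \<Longrightarrow> g (A + t *\<^sub>R e) > 0" and "t \<ge> 0"
  shows "g (A + t *\<^sub>R e) \<ge> g A"
proof -
  have gA: "g A > 0" using pos[of 0] by simp
  obtain n and \<mu> :: "nat \<Rightarrow> real" where \<mu>: "\<And>t. g (A + t *\<^sub>R e) = g A * (\<Prod>i<n. 1 + t * \<mu> i)"
    using factors_in_direction_e[OF A] gA by (metis less_irrefl)
  have "\<mu> i \<ge> 0" if "i < n" for i
  proof (rule normalized_factors_nonneg[OF _ that])
    show "g A * (\<Prod>i<n. 1 + t * \<mu> i) \<noteq> 0" if "t \<ge> 0" for t
      using pos[OF that] \<mu>[of t] by (metis less_irrefl)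
  qed
  then have "(\<Prod>i<n. 1 + t * \<mu> i) \<ge> 1" using \<open>t \<ge> 0\<close> by (intro prod_ge_1) auto
  then show ?thesis using \<mu>[of t] gA by simp
qed

lemma segment_in_cone:
  assumes "A \<in> \<Gamma>" "B \<in> S" "\<And>t. 0 \<le> t \<Longrightarrow> t \<le> 1 \<Longrightarrow> g (A + t *\<^sub>R (B - A)) \<noteq> 0"
  shows "B \<in> \<Gamma>"
proof -
  have A: "A \<in> S" using assms(1) connected_component_subset[of "{A \<in> S. g A \<noteq> 0}" e] by (auto simp: \<Gamma>_def)
  have "closed_segment A B \<subseteq> {A \<in> S. g A \<noteq> 0}"
  proof
    fix x assume "x \<in> closed_segment A B"
    then obtain u where u: "0 \<le> u" "u \<le> 1" "x = (1 - u) *\<^sub>R A + u *\<^sub>R B"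
      by (auto simp: in_segment)
    then have "x = A + u *\<^sub>R (B - A)" by (simp add: algebra_simps)
    then show "x \<in> {A \<in> S. g A \<noteq> 0}" using assms u A subspace by (auto intro: subspace_diff)
  qed
  then have "connected_component {A \<in> S. g A \<noteq> 0} A B"
    unfolding connected_component_def by (intro exI[of _ "closed_segment A B"]) auto
  then show ?thesis using assms(1) by (auto simp: \<Gamma>_def intro: connected_component_trans)
qed

lemma e_in_cone: "e \<in> \<Gamma>"
  using e_in e_pos by (auto simp: \<Gamma>_def connected_component_refl_eq)

lemma cone_subset: "\<Gamma> \<subseteq> {A \<in> S. g A \<noteq> 0}"
  unfolding \<Gamma>_def by (rule connected_component_subset)

text \<open>
  The right-hand side \<open>P\<close> is open and closed relative to the set where \<open>g \<noteq> 0\<close>. It is open because the half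
  line compactifies to the segment towards \<open>e\<close>, and closed because it can also be
  described by the weak inequalities \<open>g (A + t e) \<ge> g A \<ge> 0\<close> (\<open>increasing_in_direction_e\<close>), which is
  where real-rootedness enters. Since it is star-shaped about \<open>e\<close>, it is the component.
\<close>

lemma cone_eq: "\<Gamma> = {A \<in> S. \<forall>t\<ge>0. g (A + t *\<^sub>R e) > 0}"
proof
  obtain p where p: "real_polynomial_function p" "\<And>A. A \<in> S \<Longrightarrow> g A = p A"
    using polynomial by auto
  have cont: "continuous_on UNIV p"
    using p(1) by (simp add: continuous_on_polymonial_function real_polynomial_function_eq)
  note cont' = continuous_on_compose2[OF cont]
  define P where "P = {A \<in> S. \<forall>t\<ge>0. g (A + t *\<^sub>R e) > 0}"
  \<comment> \<open>Among the points of \<open>S\<close>, those outside \<open>P\<close> form the set \<open>U\<close>, by the substitution \<open>u = t / (1 + t)\<close>.\<close>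
  define U where "U = {A. \<exists>u\<in>{0..1}. (A, u) \<in> {(A, u). p ((1 - u) *\<^sub>R A + u *\<^sub>R e) \<le> 0}}"
  have "closed U" unfolding U_def
    by (rule closed_projection_compact)
      (auto intro!: closed_Collect_le continuous_intros cont' simp: case_prod_unfold)
  define F where "F = {A. p A \<ge> 0} \<inter> (\<Inter>t\<in>{0..}. {A. p (A + t *\<^sub>R e) \<ge> p A})"
  have "closed F" unfolding F_def
    by (intro closed_Int closed_INT closed_Collect_le continuous_intros cont' ballI) auto
  have Seg: "g ((1 - u) *\<^sub>R A + u *\<^sub>R e) > 0" if A: "A \<in> P" and u: "0 \<le> u" "u \<le> 1" for A u
  proof (cases "u = 1")
    case True then show ?thesis using e_pos by simp
  next
    case False
    then have u1: "1 - u > 0" using u by simp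
    have "(1 - u) *\<^sub>R A + u *\<^sub>R e = (1 - u) *\<^sub>R (A + (u / (1 - u)) *\<^sub>R e)"
      using u1 by (simp add: scaleR_right_distrib)
    moreover have "A + (u / (1 - u)) *\<^sub>R e \<in> S" using A e_in by (auto simp: P_def)
    ultimately have "g ((1 - u) *\<^sub>R A + u *\<^sub>R e) = (1 - u) ^ N * g (A + (u / (1 - u)) *\<^sub>R e)"
      using homogeneous by metis
    then show ?thesis using A u u1 by (simp add: P_def)
  qed
  have PU: "A \<in> P \<longleftrightarrow> A \<notin> U" if A: "A \<in> S" for A
  proof
    assume "A \<in> P"
    then show "A \<notin> U"
      using Seg A e_in p(2) subspace by (fastforce simp: U_def not_le subspace_add subspace_scale)
  next
    assume U: "A \<notin> U"
    have "g (A + t *\<^sub>R e) > 0" if "t \<ge> 0" for t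
    proof -
      define u where "u = t / (1 + t)"
      have u: "0 \<le> u" "u \<le> 1" "1 - u = 1 / (1 + t)" using that by (auto simp: u_def field_simps)
      have "(1 - u) *\<^sub>R A + u *\<^sub>R e = (1 / (1 + t)) *\<^sub>R (A + t *\<^sub>R e)"
        by (simp add: u(3)) (simp add: u_def scaleR_right_distrib)
      moreover have "p ((1 - u) *\<^sub>R A + u *\<^sub>R e) > 0"
        using U u(1,2) by (force simp: U_def not_le)
      moreover have "A + t *\<^sub>R e \<in> S" "(1 - u) *\<^sub>R A + u *\<^sub>R e \<in> S"
        using A e_in subspace by (auto simp: subspace_add subspace_scale)
      ultimately have "(1 / (1 + t)) ^ N * g (A + t *\<^sub>R e) > 0"
        using homogeneous p(2) by metis
      then show ?thesis using that by (simp add: zero_less_mult_iff)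
    qed
    then show "A \<in> P" using A by (simp add: P_def)
  qed
  have PF: "A \<in> P \<longleftrightarrow> A \<in> F" if A: "A \<in> S" "g A \<noteq> 0" for A
  proof
    assume P: "A \<in> P"
    then have "g A > 0" by (auto simp: P_def dest: spec[of _ 0])
    then show "A \<in> F"
      using P increasing_in_direction_e[of A] A p(2)[OF comb_in(1)[OF A(1) e_in]] p(2)[OF A(1)]
      by (auto simp: F_def P_def)
  next
    assume F: "A \<in> F"
    then have "g A > 0" using A p(2)[of A] by (auto simp: F_def)
    moreover have "g A \<le> g (A + t *\<^sub>R e)" if "t \<ge> 0" for t
      using F that p(2)[OF comb_in(1)[OF A(1) e_in]] p(2)[OF A(1)] by (simp add: F_def)
    ultimately show "A \<in> P" using A(1) by (force simp: P_def)
  qed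
  have eP: "e \<in> P"
  proof -
    have "g (e + t *\<^sub>R e) > 0" if "t \<ge> 0" for t
      using homogeneous[OF e_in, of "1 + t"] e_pos that by (simp add: scaleR_left_distrib)
    then show ?thesis using e_in by (simp add: P_def)
  qed
  have "connected \<Gamma>" by (simp add: \<Gamma>_def)
  moreover have "\<Gamma> \<inter> P = \<Gamma> \<inter> - U" "\<Gamma> \<inter> P = \<Gamma> \<inter> F"
    using PU PF cone_subset by blast+
  then have "openin (top_of_set \<Gamma>) (\<Gamma> \<inter> P)" "closedin (top_of_set \<Gamma>) (\<Gamma> \<inter> P)"
    using \<open>closed U\<close> \<open>closed F\<close> by (metis openin_open_Int open_Compl, metis closedin_closed_Int)
  ultimately have "\<Gamma> \<inter> P = {} \<or> \<Gamma> \<inter> P = \<Gamma>"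
    unfolding connected_clopen by blast
  then show "\<Gamma> \<subseteq> {A \<in> S. \<forall>t\<ge>0. g (A + t *\<^sub>R e) > 0}"
    using eP e_in_cone unfolding P_def by blast
  show "{A \<in> S. \<forall>t\<ge>0. g (A + t *\<^sub>R e) > 0} \<subseteq> \<Gamma>"
  proof
    fix A assume "A \<in> {A \<in> S. \<forall>t\<ge>0. g (A + t *\<^sub>R e) > 0}"
    then have A: "A \<in> P" by (simp add: P_def)
    show "A \<in> \<Gamma>"
    proof (rule segment_in_cone[OF e_in_cone])
      show "A \<in> S" using A by (simp add: P_def)
      fix t :: real assume "0 \<le> t" "t \<le> 1"
      then show "g (e + t *\<^sub>R (A - e)) \<noteq> 0" using Seg[OF A, of "1 - t"] by (simp add: algebra_simps)
    qed
  qed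
qed

lemma cone_pos: "A \<in> \<Gamma> \<Longrightarrow> g A > 0"
  unfolding cone_eq by (auto dest: spec[of _ 0])

lemma cone_in: "A \<in> \<Gamma> \<Longrightarrow> A \<in> S"
  unfolding cone_eq by simp

lemma segment_from_e_in_cone:
  assumes "A \<in> \<Gamma>" "0 \<le> u" "u \<le> 1"
  shows "(1 - u) *\<^sub>R e + u *\<^sub>R A \<in> \<Gamma>"
proof (cases "u = 0")
  case False
  then have u: "u > 0" using assms by simp
  have S: "(1 - u) *\<^sub>R e + u *\<^sub>R A \<in> S"
    using cone_in[OF assms(1)] e_in subspace by (auto simp: subspace_add subspace_scale)
  have "g ((1 - u) *\<^sub>R e + u *\<^sub>R A + t *\<^sub>R e) > 0" if "t \<ge> 0" for t
  proof -
    have eq: "(1 - u) *\<^sub>R e + u *\<^sub>R A + t *\<^sub>R e = u *\<^sub>R (A + ((1 - u + t) / u) *\<^sub>R e)"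
      using u by (simp add: scaleR_right_distrib scaleR_left_distrib)
    have "A + ((1 - u + t) / u) *\<^sub>R e \<in> S" using cone_in[OF assms(1)] e_in by auto
    moreover have "g (A + ((1 - u + t) / u) *\<^sub>R e) > 0"
      using assms(1,3) u that by (auto simp: cone_eq)
    ultimately show ?thesis unfolding eq using u homogeneous by simp
  qed
  then show ?thesis using S by (simp add: cone_eq)
qed (use e_in_cone in simp)

end

section \<open>Real-rootedness in all directions of the Garding cone\<close>

locale complexified_hyperbolic_polynomial = hyperbolic_polynomial +
  fixes G :: "'a \<times> 'a \<Rightarrow> complex" and d :: nat
  assumes continuous_G: "continuous_on UNIV G"
    and G_real: "A \<in> S \<Longrightarrow> G (A, 0) = of_real (g A)"
    and G_line: "\<exists>q. degree q \<le> d \<and> (\<forall>z. G (a + complex_scale z b) = poly q z)"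
begin

lemma G_eq_if_eq_on_reals:
  assumes "\<And>t::real. G (a + complex_scale (of_real t) b) = poly q (of_real t)"
  shows "G (a + complex_scale z b) = poly q z"
proof -
  obtain r where r: "\<And>z. G (a + complex_scale z b) = poly r z" using G_line by blast
  then have "r = q" using assms by (intro complex_poly_eq_if_eq_on_reals) metis
  then show ?thesis using r by simp
qed

text \<open>
  The identity principle is used once in the scalar, for real points, and once in the
  point, along the line \<open>A + t B\<close> evaluated at \<open>t = i\<close>.
\<close>

lemma G_homogeneous:
  assumes "A \<in> S" "B \<in> S"
  shows "G (complex_scale z (A, B)) = z ^ N * G (A, B)"
proof -
  have real: "G (complex_scale z (X, 0)) = z ^ N * G (X, 0)" if X: "X \<in> S" for X z
  proof -
    have "G (0 + complex_scale (of_real t) (X, 0)) = poly (smult (G (X, 0)) (monom 1 N)) (of_real t)" for t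
      using X subspace homogeneous[OF X] by (simp add: complex_scale_real G_real subspace_scale poly_monom)
    from G_eq_if_eq_on_reals[OF this, of z] show ?thesis by (simp add: poly_monom)
  qed
  obtain q where q: "\<And>w. G ((A, 0) + complex_scale w (B, 0)) = poly q w" using G_line by blast
  have "G (complex_scale z (A, 0) + complex_scale (of_real t) (complex_scale z (B, 0))) = poly (smult (z ^ N) q) (of_real t)" for t
  proof -
    have "complex_scale z (A, 0) + complex_scale (of_real t) (complex_scale z (B, 0)) = complex_scale z (A + t *\<^sub>R B, 0)"
      by (simp add: complex_scale_def algebra_simps)
    moreover have "(A, 0) + complex_scale (of_real t) (B, 0) = (A + t *\<^sub>R B, 0)"
      by (simp add: complex_scale_real)
    ultimately show ?thesis
      using real[OF comb_in(1)[OF assms, of t], of z] q[of "of_real t"] by simp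
  qed
  from G_eq_if_eq_on_reals[OF this, of \<i>] have "G (complex_scale z (A, 0) + complex_scale \<i> (complex_scale z (B, 0))) = z ^ N * poly q \<i>"
    by simp
  moreover have "complex_scale z (A, 0) + complex_scale \<i> (complex_scale z (B, 0)) = complex_scale z (A, B)"
    "(A, 0) + complex_scale \<i> (B, 0) = (A, B)"
    by (simp_all add: complex_scale_def)
  ultimately show ?thesis using q[of \<i>] by simp
qed

lemma zero_scale_iff:
  assumes "A \<in> S" "B \<in> S" "z \<noteq> 0"
  shows "G (complex_scale z (A, B)) = 0 \<longleftrightarrow> G (A, B) = 0"
  using assms by (simp add: G_homogeneous)

lemma G_real_roots:
  assumes A: "A \<in> S" and z: "G ((A, 0) + complex_scale z (e, 0)) = 0"
  shows "z \<in> \<real>"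
proof -
  obtain q where q: "\<And>t. poly q t = g (t *\<^sub>R e + A)" "real_rooted q"
    using real_roots[OF A] by blast
  have "G ((A, 0) + complex_scale (of_real t) (e, 0)) = poly (map_poly of_real q) (of_real t)" for t
    using A e_in G_real[OF comb_in(1)[OF A e_in, of t]] by (simp add: poly_map_poly_complex_of_real complex_scale_real q(1) add.commute)
  from G_eq_if_eq_on_reals[OF this, of z] z q(2) show ?thesis by (simp add: real_rooted_def)
qed

text \<open>
  After dividing by a real zero \<open>w \<noteq> 0\<close>, the polynomial \<open>t \<mapsto> g (t e + B / w + A)\<close> would have the
  nonreal root \<open>i\<close>. The perturbation of \<open>A\<close> by \<open>i e\<close> is there for this purpose.
\<close>

lemma nonreal_zero:
  assumes B: "B \<in> \<Gamma>" and A: "A \<in> S" and w: "G ((B, 0) + complex_scale w (A, e)) = 0"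
  shows "w \<notin> \<real>"
proof
  assume "w \<in> \<real>"
  then obtain t where t: "w = of_real t" by (auto elim: Reals_cases)
  show False
  proof (cases "t = 0")
    case True
    then show False using w t G_real[OF cone_in[OF B]] cone_pos[OF B] by simp
  next
    case False
    have S: "(1 / t) *\<^sub>R B + A \<in> S" using A cone_in[OF B] by blast
    have "(B, 0) + complex_scale w (A, e) = complex_scale w ((1 / t) *\<^sub>R B + A, e)"
      using False by (simp add: complex_scale_def t scaleR_right_distrib)
    then have "G ((1 / t) *\<^sub>R B + A, e) = 0"
      using w zero_scale_iff[OF S e_in, of w] False t by simp
    moreover have "((1 / t) *\<^sub>R B + A, e) = ((1 / t) *\<^sub>R B + A, 0) + complex_scale \<i> (e, 0)"
      by (simp add: complex_scale_def)
    ultimately have "\<i> \<in> \<real>" using G_real_roots[OF S, of \<i>] by simp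
    then show False by (simp add: complex_is_Real_iff)
  qed
qed

lemma upper_half_plane_zero_at_e:
  assumes A: "A \<in> S" and w: "G ((e, 0) + complex_scale w (A, e)) = 0"
  shows "Im w > 0"
proof -
  have w0: "w \<noteq> 0" using nonreal_zero[OF e_in_cone A w] by auto
  have "complex_scale w (complex_scale (1 / w + \<i>) (e, 0)) = complex_scale (1 + w * \<i>) (e, 0)"
    using w0 by (simp add: complex_scale_scale distrib_left)
  also have "\<dots> = (e, 0) + complex_scale w (complex_scale \<i> (e, 0))"
    by (simp only: complex_scale_add_left complex_scale_one complex_scale_scale)
  also have "complex_scale \<i> (e, 0) = (0, e)" by (simp add: complex_scale_def)
  finally have "(e, 0) + complex_scale w (A, e) = complex_scale w ((A, 0) + complex_scale (1 / w + \<i>) (e, 0))"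
    by (simp add: complex_scale_add_right) (simp add: complex_scale_def algebra_simps)
  moreover obtain X Y where XY: "(A, 0) + complex_scale (1 / w + \<i>) (e, 0) = (X, Y)" "X \<in> S" "Y \<in> S"
    using A e_in subspace by (auto simp: complex_scale_def subspace_add subspace_scale)
  ultimately have "G ((A, 0) + complex_scale (1 / w + \<i>) (e, 0)) = 0"
    using w zero_scale_iff[of X Y w] w0 by simp
  then have "1 / w + \<i> \<in> \<real>" using G_real_roots[OF A] by blast
  then have "Im (1 / w + \<i>) = 0" by (simp only: complex_is_Real_iff)
  moreover have "Im (1 / w + \<i>) = Im (1 / w) + 1" by (simp only: plus_complex.sel imaginary_unit.sel)
  moreover have "Im (1 / w) = - (Im w / (norm w)\<^sup>2)" by (simp add: Im_divide cmod_power2)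
  ultimately have "Im w / (norm w)\<^sup>2 = 1" by linarith
  then have "Im w = (norm w)\<^sup>2" by (metis divide_eq_1_iff)
  also have "\<dots> > 0" using w0 by (intro zero_less_power) simp
  finally show ?thesis .
qed

lemma norm_G_lower_bound:
  assumes B: "B \<in> \<Gamma>" and w: "Im w < 0"
    and zeros: "\<And>z. G ((B, 0) + complex_scale z b) = 0 \<Longrightarrow> Im z > 0"
  shows "norm (G ((B, 0) + complex_scale w b)) \<ge> g B * (\<bar>Im w\<bar> / norm w) ^ d"
proof -
  obtain q where q: "degree q \<le> d" "\<And>z. G ((B, 0) + complex_scale z b) = poly q z"
    using G_line by blast
  have "poly q 0 = of_real (g B)" using q(2)[of 0] G_real[OF cone_in[OF B]] by simp
  then show ?thesis
    using norm_poly_lower_bound_upper_half_plane[of q d w] q zeros w cone_pos[OF B] by simp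
qed

text \<open>
  A homotopy from \<open>e\<close>, where the zeros are known explicitly, to \<open>B\<close>. The set \<open>bad\<close> of parameters with
  a zero in the closed lower half plane is open by the lower bound
  \<open>norm_G_lower_bound\<close>, since a zero never lies on the real axis. It is closed because the zeros form a
  compact set in homogeneous coordinates \<open>(z1, z2)\<close>, and the point at infinity is never one of them, as
  \<open>G (A, e) \<noteq> 0\<close>. By connectedness it is empty, since it does not contain \<open>0\<close>.
\<close>

lemma upper_half_plane_zeros:
  assumes B: "B \<in> \<Gamma>" and A: "A \<in> S" and w: "G ((B, 0) + complex_scale w (A, e)) = 0"
  shows "Im w > 0"
proof -
  define P where "P \<theta> = (1 - \<theta>) *\<^sub>R e + \<theta> *\<^sub>R B" for \<theta> :: real
  have P: "P \<theta> \<in> \<Gamma>" if "\<theta> \<in> {0..1}" for \<theta>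
    unfolding P_def using segment_from_e_in_cone[OF B] that by simp
  have PS: "P \<theta> \<in> S" for \<theta>
    unfolding P_def using e_in cone_in[OF B] subspace by (simp add: subspace_add subspace_scale)
  define h where "h w \<theta> = G ((P \<theta>, 0) + complex_scale w (A, e))" for w \<theta>
  note cont_G = continuous_on_compose2[OF continuous_G]
  have cont_P: "continuous_on T (\<lambda>x. P (f x))" if "continuous_on T f" for T and f :: "'c::topological_space \<Rightarrow> real"
    unfolding P_def by (intro continuous_intros that)
  define bad where "bad = {\<theta> \<in> {0..1}. \<exists>w. Im w \<le> 0 \<and> h w \<theta> = 0}"
  have "openin (top_of_set {0..1}) bad"
  proof (subst openin_subopen, intro ballI)
    fix \<theta>0 assume "\<theta>0 \<in> bad"
    then obtain w where \<theta>0: "\<theta>0 \<in> {0..1}" and w: "Im w \<le> 0" "h w \<theta>0 = 0" by (auto simp: bad_def)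
    have Imw: "Im w < 0"
      using w nonreal_zero[OF P[OF \<theta>0] A, of w] by (auto simp: h_def complex_is_Real_iff)
    define T where "T = {\<theta>. norm (h w \<theta>) < norm (G (P \<theta>, 0)) * (\<bar>Im w\<bar> / norm w) ^ d}"
    have "open T" unfolding T_def h_def
      by (intro open_Collect_less continuous_intros cont_G cont_P) auto
    moreover have "0 < g (P \<theta>0) * (\<bar>Im w\<bar> / norm w) ^ d"
      using Imw cone_pos[OF P[OF \<theta>0]] by (intro mult_pos_pos zero_less_power divide_pos_pos) auto
    then have "\<theta>0 \<in> T"
      using w(2) cone_pos[OF P[OF \<theta>0]] G_real[OF PS] by (simp add: T_def)
    moreover have "{0..1} \<inter> T \<subseteq> bad"
    proof
      fix \<theta> assume \<theta>: "\<theta> \<in> {0..1} \<inter> T"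
      show "\<theta> \<in> bad"
      proof (rule ccontr)
        assume "\<theta> \<notin> bad"
        then have "\<And>z. G ((P \<theta>, 0) + complex_scale z (A, e)) = 0 \<Longrightarrow> Im z > 0"
          using \<theta> by (force simp: bad_def h_def)
        then have "g (P \<theta>) * (\<bar>Im w\<bar> / norm w) ^ d \<le> norm (h w \<theta>)"
          unfolding h_def using \<theta> by (intro norm_G_lower_bound[OF P Imw]) auto
        then show False
          using \<theta> cone_pos[OF P, of \<theta>] G_real[OF PS, of \<theta>] by (auto simp: T_def)
      qed
    qed
    ultimately show "\<exists>T. openin (top_of_set {0..1}) T \<and> \<theta>0 \<in> T \<and> T \<subseteq> bad"
      using \<theta>0 by (intro exI[of _ "{0..1} \<inter> T"]) auto
  qed
  moreover have "closedin (top_of_set {0..1}) bad"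
  proof -
    define C where "C = {(\<theta>, z). Im (snd z * cnj (fst z)) \<le> 0 \<and>
      G (complex_scale (fst z) (P \<theta>, 0) + complex_scale (snd z) (A, e)) = 0}"
    have "closed C" unfolding C_def case_prod_unfold
      by (intro closed_Collect_conj closed_Collect_le closed_Collect_eq continuous_intros cont_G cont_P) auto
    moreover have "compact (sphere 0 1 :: (complex \<times> complex) set)" by simp
    ultimately have "closed {\<theta>. \<exists>z\<in>sphere 0 1. (\<theta>, z) \<in> C}" by (intro closed_projection_compact)
    moreover have "bad = {0..1} \<inter> {\<theta>. \<exists>z\<in>sphere 0 1. (\<theta>, z) \<in> C}"
    proof (intro equalityI subsetI)
      fix \<theta> assume "\<theta> \<in> bad"
      then obtain w where \<theta>: "\<theta> \<in> {0..1}" and w: "Im w \<le> 0" "h w \<theta> = 0" by (auto simp: bad_def)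
      define r where "r = 1 / norm (1 :: complex, w)"
      have n: "norm (1 :: complex, w) \<noteq> 0" by (simp add: zero_prod_def)
      then have r: "r > 0" by (simp add: r_def)
      define z where "z = (complex_of_real r, of_real r * w)"
      have "z = r *\<^sub>R (1, w)" by (simp add: z_def scaleR_conv_of_real)
      then have "norm z = \<bar>r\<bar> * norm (1 :: complex, w)" by (simp only: norm_scaleR)
      then have "norm z = 1" using n by (simp add: r_def)
      moreover have "(\<theta>, z) \<in> C"
      proof -
        obtain X Y where XY: "(P \<theta>, 0) + complex_scale w (A, e) = (X, Y)" "X \<in> S" "Y \<in> S"
          using A e_in PS subspace by (auto simp: complex_scale_def subspace_add subspace_scale subspace_diff)
        have "complex_scale (fst z) (P \<theta>, 0) + complex_scale (snd z) (A, e) = complex_scale (of_real r) (X, Y)"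
          unfolding XY(1)[symmetric] by (simp add: z_def complex_scale_add_right complex_scale_scale)
        then have "G (complex_scale (fst z) (P \<theta>, 0) + complex_scale (snd z) (A, e)) = 0"
          using w(2) XY r by (simp add: zero_scale_iff h_def)
        then show ?thesis using w(1) r by (simp add: C_def z_def mult_le_0_iff)
      qed
      ultimately show "\<theta> \<in> {0..1} \<inter> {\<theta>. \<exists>z\<in>sphere 0 1. (\<theta>, z) \<in> C}" using \<theta> by auto
    next
      fix \<theta> assume "\<theta> \<in> {0..1} \<inter> {\<theta>. \<exists>z\<in>sphere 0 1. (\<theta>, z) \<in> C}"
      then obtain z1 z2 where \<theta>: "\<theta> \<in> {0..1}" and z: "norm (z1, z2) = 1" "Im (z2 * cnj z1) \<le> 0"
          "G (complex_scale z1 (P \<theta>, 0) + complex_scale z2 (A, e)) = 0"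
        by (auto simp: C_def)
      \<comment> \<open>The point at infinity is not a zero.\<close>
      have z1: "z1 \<noteq> 0"
      proof
        assume z1: "z1 = 0"
        then have "z2 \<noteq> 0" using z(1) by auto
        then have "G (A, e) = 0" using z(3) z1 zero_scale_iff[OF A e_in] by simp
        then have "G ((A, 0) + complex_scale \<i> (e, 0)) = 0" by (simp add: complex_scale_def)
        then have "\<i> \<in> \<real>" by (rule G_real_roots[OF A])
        then show False by (simp add: complex_is_Real_iff)
      qed
      obtain X Y where XY: "(P \<theta>, 0) + complex_scale (z2 / z1) (A, e) = (X, Y)" "X \<in> S" "Y \<in> S"
        using A e_in PS subspace by (auto simp: complex_scale_def subspace_add subspace_scale subspace_diff)
      have "complex_scale z1 (P \<theta>, 0) + complex_scale z2 (A, e) = complex_scale z1 (X, Y)"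
        unfolding XY(1)[symmetric] using z1 by (simp add: complex_scale_add_right complex_scale_scale)
      then have "h (z2 / z1) \<theta> = 0" using z(3) z1 XY by (simp add: zero_scale_iff h_def)
      moreover have "z2 / z1 = (z2 * cnj z1) / of_real ((norm z1)\<^sup>2)"
        using z1 by (simp add: complex_div_cnj[of z2 z1] of_real_power)
      then have "Im (z2 / z1) = Im (z2 * cnj z1) / (norm z1)\<^sup>2"
        by (metis Im_divide_of_real)
      then have "Im (z2 / z1) \<le> 0" using z(2) by (simp add: divide_nonpos_nonneg del: times_complex.sel)
      ultimately show "\<theta> \<in> bad" using \<theta> by (auto simp: bad_def)
    qed
    ultimately show ?thesis by (simp add: closedin_closed_Int)
  qed
  ultimately have "bad = {} \<or> bad = {0..1}"
    using connected_Icc[of 0 "1::real"] unfolding connected_clopen by blast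
  moreover have "0 \<notin> bad"
    using upper_half_plane_zero_at_e[OF A] by (force simp: bad_def h_def P_def)
  ultimately have "1 \<notin> bad" by auto
  then show ?thesis using w by (force simp: bad_def h_def P_def)
qed

text \<open>
  The perturbation \<open>A + i \<epsilon> e\<close> has its zeros in the upper half plane, with a lower bound at points of the
  lower half plane that is uniform in \<open>\<epsilon>\<close>. Letting \<open>\<epsilon>\<close> tend to \<open>0\<close> excludes the lower half plane; replacing
  \<open>A\<close> by \<open>- A\<close> reflects the zeros and excludes the upper half plane.
\<close>

lemma zeros_real:
  assumes B: "B \<in> \<Gamma>" and A: "A \<in> S" and w: "G ((B, 0) + complex_scale w (A, 0)) = 0"
  shows "w \<in> \<real>"
proof -
  have *: "\<not> Im w < 0" if A: "A \<in> S" and w: "G ((B, 0) + complex_scale w (A, 0)) = 0" for A w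
  proof
    assume Imw: "Im w < 0"
    define c where "c = g B * (\<bar>Im w\<bar> / norm w) ^ d"
    have c: "c > 0" unfolding c_def
      using cone_pos[OF B] Imw by (intro mult_pos_pos zero_less_power divide_pos_pos) auto
    define F where "F \<epsilon> = norm (G ((B, 0) + complex_scale w (A, \<epsilon> *\<^sub>R e)))" for \<epsilon> :: real
    have bound: "F \<epsilon> \<ge> c" if "\<epsilon> > 0" for \<epsilon>
      unfolding F_def c_def
    proof (rule norm_G_lower_bound[OF B Imw])
      fix z assume "G ((B, 0) + complex_scale z (A, \<epsilon> *\<^sub>R e)) = 0"
      moreover have "complex_scale z (A, \<epsilon> *\<^sub>R e) = complex_scale (of_real \<epsilon> * z) ((1 / \<epsilon>) *\<^sub>R A, e)"
        using that by (simp add: complex_scale_def)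
      ultimately have "Im (of_real \<epsilon> * z) > 0"
        using upper_half_plane_zeros[OF B, of "(1 / \<epsilon>) *\<^sub>R A" "of_real \<epsilon> * z"] A subspace
        by (simp add: subspace_scale)
      then show "Im z > 0" using that by (simp add: zero_less_mult_iff)
    qed
    have "continuous_on UNIV F" unfolding F_def
      by (intro continuous_intros continuous_on_compose2[OF continuous_G]) auto
    then have "isCont F 0" by (simp add: continuous_on_eq_continuous_at)
    then have "(F \<longlongrightarrow> F 0) (at_right 0)" unfolding isCont_def by (rule filterlim_mono) (auto simp: at_le)
    moreover have "eventually (\<lambda>\<epsilon>. c \<le> F \<epsilon>) (at_right 0)"
      unfolding eventually_at_topological using bound by (intro exI[of _ UNIV]) auto
    ultimately have "c \<le> F 0" by (intro tendsto_lowerbound) auto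
    then show False using c w by (simp add: F_def)
  qed
  have "complex_scale (- w) (- A, 0) = complex_scale w (A, 0)" by (simp add: complex_scale_def)
  then have "\<not> Im (- w) < 0" using *[of "- A" "- w"] w A subspace by (simp add: subspace_neg)
  then show ?thesis using *[OF A w] by (simp add: complex_is_Real_iff)
qed

lemma real_rooted_line:
  assumes B: "B \<in> \<Gamma>" and A: "A \<in> S"
  shows "\<exists>q. (\<forall>t. poly q t = g (B + t *\<^sub>R A)) \<and> real_rooted q"
proof -
  obtain q :: "real poly" where q: "\<And>t. g (B + t *\<^sub>R A) = poly q t"
    using line_polynomial[OF cone_in[OF B] A] by blast
  have "G ((B, 0) + complex_scale (of_real t) (A, 0)) = poly (map_poly of_real q) (of_real t)" for t
    using G_real[OF comb_in(1)[OF cone_in[OF B] A, of t]] by (simp add: poly_map_poly_complex_of_real complex_scale_real q)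
  note Q = G_eq_if_eq_on_reals[OF this]
  then show ?thesis
    using q zeros_real[OF B A] by (intro exI[of _ q]) (simp add: real_rooted_def)
qed

text \<open>
  Every point of the cone may thus play the role of \<open>e\<close>, and everything proved about the direction
  \<open>e\<close> holds for all directions in the cone.
\<close>

lemma hyperbolic_in_cone_direction:
  assumes B: "B \<in> \<Gamma>"
  shows "hyperbolic_polynomial S g N B"
proof
  show "subspace S" "\<exists>p. real_polynomial_function p \<and> (\<forall>A\<in>S. g A = p A)" "B \<in> S" "0 < g B"
    using subspace polynomial cone_in[OF B] cone_pos[OF B] by auto
  show "g (t *\<^sub>R A) = t ^ N * g A" if "A \<in> S" for A t using homogeneous that by blast
  fix A assume A: "A \<in> S"
  obtain q :: "real poly" where q: "\<And>t. g (A + t *\<^sub>R B) = poly q t"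
    using line_polynomial[OF A cone_in[OF B]] by blast
  have "G ((A, 0) + complex_scale (of_real t) (B, 0)) = poly (map_poly of_real q) (of_real t)" for t
    using G_real[OF comb_in(1)[OF A cone_in[OF B], of t]] by (simp add: poly_map_poly_complex_of_real complex_scale_real q)
  note Q = G_eq_if_eq_on_reals[OF this]
  have "z \<in> \<real>" if "poly (map_poly of_real q) z = 0" for z :: complex
  proof (cases "z = 0")
    case False
    obtain X Y where XY: "(B, 0) + complex_scale (1 / z) (A, 0) = (X, Y)" "X \<in> S" "Y \<in> S"
      using A cone_in[OF B] subspace by (auto simp: complex_scale_def subspace_add subspace_scale)
    have "(A, 0) + complex_scale z (B, 0) = complex_scale z (X, Y)"
      unfolding XY(1)[symmetric] using False by (simp add: complex_scale_add_right complex_scale_scale add.commute)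
    then have "G ((B, 0) + complex_scale (1 / z) (A, 0)) = 0"
      using that Q[of z] zero_scale_iff[OF XY(2,3) False] XY(1) by simp
    then have "1 / z \<in> \<real>" by (rule zeros_real[OF B A])
    then have "inverse (1 / z) \<in> \<real>" by (rule Reals_inverse)
    then show ?thesis by simp
  qed simp
  then show "\<exists>q. (\<forall>t. poly q t = g (t *\<^sub>R B + A)) \<and> real_rooted q"
    using q by (intro exI[of _ q]) (simp add: real_rooted_def add.commute)
qed

end

section \<open>Monotonicity and concavity on the Garding cone\<close>

context hyperbolic_polynomial
begin

lemma obtain_complexification:
  obtains G d where "complexified_hyperbolic_polynomial S g N e G d"
proof -
  obtain p where p: "real_polynomial_function p" "\<And>A. A \<in> S \<Longrightarrow> g A = p A"
    using polynomial by auto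
  obtain G d where "continuous_on UNIV G" "\<And>x. G (x, 0) = complex_of_real (p x)"
    "\<And>a b. \<exists>q. degree q \<le> d \<and> (\<forall>z. G (a + complex_scale z b) = poly q z)"
    using polynomial_complexification[OF p(1)] by blast
  then have "complexified_hyperbolic_polynomial S g N e G d"
    by unfold_locales (use p in auto)
  then show ?thesis by (rule that)
qed

lemma hyperbolic_in_direction:
  assumes "B \<in> \<Gamma>"
  shows "hyperbolic_polynomial S g N B"
  using assms complexified_hyperbolic_polynomial.hyperbolic_in_cone_direction
  by (metis obtain_complexification)

lemma cone_in_direction:
  assumes B: "B \<in> \<Gamma>"
  shows "hyperbolic_polynomial.\<Gamma> S g B = \<Gamma>"
  unfolding hyperbolic_polynomial.\<Gamma>_def[OF hyperbolic_in_direction[OF B]]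
  using B by (metis \<Gamma>_def connected_component_eq)

lemma cone_eq_direction:
  assumes "B \<in> \<Gamma>"
  shows "\<Gamma> = {A \<in> S. \<forall>t\<ge>0. g (A + t *\<^sub>R B) > 0}"
  using hyperbolic_polynomial.cone_eq[OF hyperbolic_in_direction[OF assms]] cone_in_direction[OF assms]
  by simp

lemma cone_add:
  assumes A: "A \<in> \<Gamma>" and B: "B \<in> \<Gamma>"
  shows "A + B \<in> \<Gamma>"
proof -
  have "g (A + B + t *\<^sub>R B) > 0" if "t \<ge> 0" for t
  proof -
    have "g (A + (1 + t) *\<^sub>R B) > 0"
      using A that unfolding cone_eq_direction[OF B] by (auto dest: spec[of _ "1 + t"])
    then show ?thesis by (simp add: scaleR_left_distrib algebra_simps)
  qed
  then show ?thesis
    using cone_in[OF A] cone_in[OF B] subspace unfolding cone_eq_direction[OF B]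
    by (simp add: subspace_add)
qed

lemma cone_scale:
  assumes A: "A \<in> \<Gamma>" and "c > 0"
  shows "c *\<^sub>R A \<in> \<Gamma>"
proof -
  have "g (c *\<^sub>R A + t *\<^sub>R e) > 0" if "t \<ge> 0" for t
  proof -
    have eq: "c *\<^sub>R A + t *\<^sub>R e = c *\<^sub>R (A + (t / c) *\<^sub>R e)"
      using \<open>c > 0\<close> by (simp add: scaleR_right_distrib)
    have "A + (t / c) *\<^sub>R e \<in> S" using cone_in[OF A] e_in by blast
    then show ?thesis unfolding eq using A that \<open>c > 0\<close> by (simp add: homogeneous cone_eq)
  qed
  then show ?thesis using cone_in[OF A] subspace by (simp add: cone_eq subspace_scale)
qed

lemma closure_cone_scale:
  assumes A: "A \<in> closure \<Gamma>" and "c > 0"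
  shows "c *\<^sub>R A \<in> closure \<Gamma>"
proof -
  obtain a where a: "\<And>n. a n \<in> \<Gamma>" "a \<longlonglongrightarrow> A"
    using A unfolding closure_sequential by blast
  have "(\<lambda>n. c *\<^sub>R a n) \<longlonglongrightarrow> c *\<^sub>R A" by (intro tendsto_intros a)
  then show ?thesis
    unfolding closure_sequential using a(1) cone_scale[OF _ \<open>c > 0\<close>]
    by (intro exI[of _ "\<lambda>n. c *\<^sub>R a n"]) simp
qed

lemma closure_cone_add:
  assumes A: "A \<in> closure \<Gamma>" and B: "B \<in> closure \<Gamma>"
  shows "A + B \<in> closure \<Gamma>"
proof -
  obtain a b where a: "\<And>n. a n \<in> \<Gamma>" "a \<longlonglongrightarrow> A" and b: "\<And>n. b n \<in> \<Gamma>" "b \<longlonglongrightarrow> B"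
    using A B unfolding closure_sequential by blast
  have "(\<lambda>n. a n + b n) \<longlonglongrightarrow> A + B" by (intro tendsto_intros a b)
  then show ?thesis
    unfolding closure_sequential using a(1) b(1) cone_add
    by (intro exI[of _ "\<lambda>n. a n + b n"]) simp
qed

lemma increasing_in_cone_direction:
  assumes A: "A \<in> \<Gamma>" and B: "B \<in> \<Gamma>"
  shows "g A \<le> g (A + B)"
  using hyperbolic_polynomial.increasing_in_direction_e[OF hyperbolic_in_direction[OF B], of A 1]
    A cone_in[OF A] unfolding cone_eq_direction[OF B] by simp

lemma factors_in_direction:
  assumes B: "B \<in> \<Gamma>" and A: "A \<in> S"
  obtains n and \<mu> :: "nat \<Rightarrow> real" where "\<And>t. g (B + t *\<^sub>R A) = g B * (\<Prod>i<n. 1 + t * \<mu> i)"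
proof -
  obtain q where q: "\<And>t. poly q t = g (B + t *\<^sub>R A)" "real_rooted q"
    using complexified_hyperbolic_polynomial.real_rooted_line[OF _ B A]
    by (metis obtain_complexification)
  have q0: "poly q 0 = g B" using q(1)[of 0] by simp
  then have "poly q 0 \<noteq> 0" using cone_pos[OF B] by simp
  then obtain n and \<mu> :: "nat \<Rightarrow> real" where \<mu>: "\<And>t. poly q t = poly q 0 * (\<Prod>i<n. 1 + t * \<mu> i)"
    using real_rooted_normalized_factors[OF q(2)] by blast
  have "g (B + t *\<^sub>R A) = g B * (\<Prod>i<n. 1 + t * \<mu> i)" for t
    using \<mu>[of t] q(1)[of t] q0 by simp
  then show ?thesis by (rule that)
qed

lemma cone_nbhd:
  assumes B: "B \<in> \<Gamma>"
  obtains r where "r > 0" "\<And>A. A \<in> S \<Longrightarrow> dist A B < r \<Longrightarrow> A \<in> \<Gamma>"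
proof -
  have "\<exists>r>0. \<forall>A\<in>S. dist A B < r \<longrightarrow> dist (g A) (g B) < g B"
    using continuous_on_S cone_in[OF B] cone_pos[OF B] unfolding continuous_on_iff by blast
  then obtain r where r: "r > 0" "\<And>A. A \<in> S \<Longrightarrow> dist A B < r \<Longrightarrow> dist (g A) (g B) < g B"
    by blast
  have "A \<in> \<Gamma>" if A: "A \<in> S" "dist A B < r" for A
  proof (rule segment_in_cone[OF B A(1)])
    fix t :: real assume t: "0 \<le> t" "t \<le> 1"
    have "dist (B + t *\<^sub>R (A - B)) B = t * dist A B" using t by (simp add: dist_norm)
    also have "\<dots> \<le> dist A B" using t by (simp add: mult_left_le_one_le)
    finally have "dist (B + t *\<^sub>R (A - B)) B < r" using A by simp
    moreover have "B + t *\<^sub>R (A - B) \<in> S"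
      using A cone_in[OF B] subspace by (simp add: subspace_add subspace_scale subspace_diff)
    ultimately have "dist (g (B + t *\<^sub>R (A - B))) (g B) < g B" by (rule r(2)[rotated])
    then show "g (B + t *\<^sub>R (A - B)) \<noteq> 0" by (auto simp: dist_real_def)
  qed
  then show ?thesis using r(1) that by blast
qed

text \<open>
  The inequality is the limit of monotonicity in directions of the open cone; it keeps \<open>g\<close> positive on the
  segment from \<open>A\<close> to \<open>A + P\<close>, which therefore stays in the component.
\<close>

lemma cone_in_closure_direction:
  assumes A: "A \<in> \<Gamma>" and P: "P \<in> closure \<Gamma>" and PS: "P \<in> S"
  shows "g A \<le> g (A + P)" and "A + P \<in> \<Gamma>"
proof -
  have le: "g A \<le> g (A + Q)" if A: "A \<in> \<Gamma>" and Q: "Q \<in> closure \<Gamma>" "Q \<in> S" for A Q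
  proof -
    obtain R where R: "\<And>n. R n \<in> \<Gamma>" "R \<longlonglongrightarrow> Q"
      using Q(1) unfolding closure_sequential by blast
    have "(\<lambda>n. g (A + R n)) \<longlonglongrightarrow> g (A + Q)"
      using Q(2) cone_in[OF A] cone_in[OF R(1)] subspace
      by (intro continuous_on_tendsto_compose[OF continuous_on_S] tendsto_intros R(2))
        (auto simp: subspace_add)
    then show ?thesis
      using increasing_in_cone_direction[OF A R(1)] by (intro LIMSEQ_le_const) auto
  qed
  show "g A \<le> g (A + P)" using le[OF A P PS] .
  note closure = closure_cone_scale[OF P]
  show "A + P \<in> \<Gamma>"
  proof (rule segment_in_cone[OF A])
    show "A + P \<in> S" using cone_in[OF A] PS subspace by (simp add: subspace_add)
    fix t :: real assume t: "0 \<le> t" "t \<le> 1"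
    have "g A \<le> g (A + t *\<^sub>R P)"
    proof (cases "t = 0")
      case False
      then show ?thesis using t PS subspace by (intro le[OF A closure]) (auto simp: subspace_scale)
    qed simp
    then show "g (A + t *\<^sub>R (A + P - A)) \<noteq> 0" using cone_pos[OF A] by simp
  qed
qed

lemma closure_cone_nonzero:
  assumes "A \<in> closure \<Gamma>" "A \<in> S" "g A \<noteq> 0"
  shows "A \<in> \<Gamma>"
proof -
  have "\<exists>r>0. \<forall>B\<in>S. dist B A < r \<longrightarrow> dist (g B) (g A) < \<bar>g A\<bar>"
    using continuous_on_S assms(2,3) unfolding continuous_on_iff by (metis zero_less_abs_iff)
  then obtain r where r: "r > 0" "\<And>B. B \<in> S \<Longrightarrow> dist B A < r \<Longrightarrow> dist (g B) (g A) < \<bar>g A\<bar>"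
    by blast
  obtain B where B: "B \<in> \<Gamma>" "dist B A < r"
    using assms(1) r(1) unfolding closure_approachable by blast
  show ?thesis
  proof (rule segment_in_cone[OF B(1) assms(2)])
    fix t :: real assume t: "0 \<le> t" "t \<le> 1"
    have "B + t *\<^sub>R (A - B) - A = (1 - t) *\<^sub>R (B - A)" by (simp add: algebra_simps)
    then have "dist (B + t *\<^sub>R (A - B)) A = (1 - t) * dist B A" using t by (simp add: dist_norm)
    also have "\<dots> \<le> dist B A" using t by (simp add: mult_left_le_one_le)
    finally have "dist (B + t *\<^sub>R (A - B)) A < r" using B by simp
    moreover have "B + t *\<^sub>R (A - B) \<in> S"
      using assms cone_in[OF B(1)] subspace by (simp add: subspace_add subspace_scale subspace_diff)
    ultimately have "dist (g (B + t *\<^sub>R (A - B))) (g A) < \<bar>g A\<bar>" by (rule r(2)[rotated])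
    then show "g (B + t *\<^sub>R (A - B)) \<noteq> 0" by (auto simp: dist_real_def)
  qed
qed

text \<open>
  A form of strict concavity of \<open>ln g\<close> on lines. With \<open>g (B + t T) = g B * (\<Prod>i<n. 1 + t * \<mu> i)\<close> and \<open>m\<close>
  the sum of the \<open>\<mu> i\<close>, the inequality \<open>1 + x \<le> exp x\<close> bounds the product by \<open>exp (t * m)\<close> in
  both directions. An increase at \<open>t = s\<close> gives \<open>m > 0\<close>, and then the bound at \<open>t = - c\<close> is below \<open>1\<close>.
\<close>

lemma strict_decrease_backwards:
  assumes B: "B \<in> \<Gamma>" and T: "T \<in> S" and s: "s > 0" and c: "c > 0"
    and fwd: "B + s *\<^sub>R T \<in> \<Gamma>" "g (B + s *\<^sub>R T) > g B" and bwd: "B - c *\<^sub>R T \<in> \<Gamma>"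
  shows "g (B - c *\<^sub>R T) < g B"
proof -
  obtain n and \<mu> :: "nat \<Rightarrow> real" where \<mu>: "\<And>t. g (B + t *\<^sub>R T) = g B * (\<Prod>i<n. 1 + t * \<mu> i)"
    using factors_in_direction[OF B T] by blast
  have pos: "g (B + t *\<^sub>R T) > 0" if t: "- c \<le> t" "t \<le> s" for t
  proof -
    \<comment> \<open>Convexity: the cone contains the segments from \<open>B\<close> to both end points.\<close>
    have *: "B + r *\<^sub>R T \<in> \<Gamma>" if "B + u *\<^sub>R T \<in> \<Gamma>" "0 \<le> r / u" "r / u \<le> 1" "u \<noteq> 0" for r u
    proof (cases "r / u = 0 \<or> r / u = 1")
      case True
      then show ?thesis using that B by auto
    next
      case False
      then have "0 < r / u" "0 < 1 - r / u" using that(2,3) by linarith+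
      then have "(r / u) *\<^sub>R (B + u *\<^sub>R T) \<in> \<Gamma>" "(1 - r / u) *\<^sub>R B \<in> \<Gamma>"
        using that(1) B by (blast intro: cone_scale)+
      from cone_add[OF this] show ?thesis using that(4) by (simp add: algebra_simps)
    qed
    have "B + t *\<^sub>R T \<in> \<Gamma>"
      using *[of s t] *[of "- c" t] fwd bwd s c t by (cases "t \<ge> 0") (auto simp: field_simps)
    then show ?thesis by (rule cone_pos)
  qed
  have fac: "1 + t * \<mu> i > 0" if t: "t = - c \<or> t = s" and i: "i < n" for t i
  proof (rule ccontr)
    assume neg: "\<not> 1 + t * \<mu> i > 0"
    define r where "r = - 1 / \<mu> i"
    have "\<mu> i \<noteq> 0" using neg by auto
    then have "1 + r * \<mu> i = 0" by (simp add: r_def)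
    then have "g (B + r *\<^sub>R T) = 0" using \<mu>[of r] i by (auto simp: prod_zero_iff)
    moreover have "- c \<le> r" "r \<le> s"
      using neg t s c \<open>\<mu> i \<noteq> 0\<close> by (auto simp: r_def divide_simps mult.commute split: if_splits; smt (verit) mult_pos_pos mult_neg_neg mult_pos_neg)+
    ultimately show False using pos[of r] by simp
  qed
  have bound: "(\<Prod>i<n. 1 + t * \<mu> i) \<le> exp (t * (\<Sum>i<n. \<mu> i))" if "t = - c \<or> t = s" for t
  proof -
    have "(\<Prod>i<n. 1 + t * \<mu> i) \<le> (\<Prod>i<n. exp (t * \<mu> i))"
      using fac[OF that] by (intro prod_mono) (auto simp: less_imp_le)
    then show ?thesis by (simp add: exp_sum sum_distrib_left)
  qed
  have gB: "g B > 0" by (rule cone_pos[OF B])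
  have "1 < (\<Prod>i<n. 1 + s * \<mu> i)" using fwd(2) \<mu>[of s] gB by simp
  also have "\<dots> \<le> exp (s * (\<Sum>i<n. \<mu> i))" by (rule bound) simp
  finally have "(\<Sum>i<n. \<mu> i) > 0" using s by (simp add: zero_less_mult_iff)
  then have "exp (- c * (\<Sum>i<n. \<mu> i)) < 1" using c by simp
  then have "(\<Prod>i<n. 1 + - c * \<mu> i) < 1" using bound[of "- c"] by (meson le_less_trans)
  then show ?thesis using \<mu>[of "- c"] gB by simp
qed

text \<open>
  The factors \<open>1 + t * \<mu> i\<close> have \<open>\<mu> i \<ge> 0\<close>, so a bounded product forces all \<open>\<mu> i\<close> to vanish. Hence \<open>g\<close> is
  constant on the whole line, the line stays in the cone, and \<open>- P\<close> is the limit of \<open>B / t - P\<close>.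
\<close>

lemma bounded_direction_in_edge:
  assumes B: "B \<in> \<Gamma>" and P: "P \<in> closure \<Gamma>" and PS: "P \<in> S"
    and bdd: "\<And>t. t \<ge> 0 \<Longrightarrow> g (B + t *\<^sub>R P) \<le> M"
  shows "- P \<in> closure \<Gamma>"
proof -
  obtain n and \<mu> :: "nat \<Rightarrow> real" where \<mu>: "\<And>t. g (B + t *\<^sub>R P) = g B * (\<Prod>i<n. 1 + t * \<mu> i)"
    using factors_in_direction[OF B PS] by blast
  have gB: "g B > 0" by (rule cone_pos[OF B])
  note closure = closure_cone_scale[OF P]
  have pos: "g (B + t *\<^sub>R P) > 0" if "t \<ge> 0" for t
  proof (cases "t = 0")
    case False
    then have "B + t *\<^sub>R P \<in> \<Gamma>"
      using that PS subspace by (intro cone_in_closure_direction(2)[OF B closure]) (auto simp: subspace_scale)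
    then show ?thesis by (rule cone_pos)
  qed (use gB in simp)
  have \<mu>_nonneg: "\<mu> i \<ge> 0" if "i < n" for i
  proof (rule normalized_factors_nonneg[OF _ that])
    show "g B * (\<Prod>i<n. 1 + t * \<mu> i) \<noteq> 0" if "t \<ge> 0" for t
      using pos[OF that] \<mu>[of t] by (metis less_irrefl)
  qed
  have \<mu>_zero: "\<mu> j = 0" if j: "j < n" for j
  proof (rule ccontr)
    assume "\<mu> j \<noteq> 0"
    then have \<mu>j: "\<mu> j > 0" using \<mu>_nonneg[OF j] by simp
    \<comment> \<open>At this \<open>t\<close> the single factor \<open>1 + t * \<mu> j\<close> already lifts \<open>g\<close> to \<open>g B + \<bar>M\<bar>\<close>.\<close>
    define t where "t = (\<bar>M\<bar> / g B) / \<mu> j"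
    have t: "t \<ge> 0" using gB \<mu>j by (simp add: t_def)
    have "(\<Prod>i<n. 1 + t * \<mu> i) = (1 + t * \<mu> j) * (\<Prod>i\<in>{..<n} - {j}. 1 + t * \<mu> i)"
      using j by (subst prod.remove[of _ j]) auto
    moreover have "(\<Prod>i\<in>{..<n} - {j}. 1 + t * \<mu> i) \<ge> 1"
      using t \<mu>_nonneg by (intro prod_ge_1) auto
    moreover have "1 + t * \<mu> j \<ge> 0" using t \<mu>j by simp
    ultimately have "(\<Prod>i<n. 1 + t * \<mu> i) \<ge> 1 + t * \<mu> j"
      using mult_left_mono[of 1] by fastforce
    then have "g B * (1 + t * \<mu> j) \<le> M"
      using bdd[OF t] \<mu>[of t] gB by (smt (verit) mult_left_mono)
    moreover have "g B * (1 + t * \<mu> j) = g B + \<bar>M\<bar>" using gB \<mu>j by (simp add: t_def field_simps)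
    ultimately show False using gB by linarith
  qed
  have const: "g (B + t *\<^sub>R P) = g B" for t using \<mu>[of t] \<mu>_zero by simp
  have line: "B + t *\<^sub>R P \<in> \<Gamma>" for t
    by (rule segment_in_cone[OF B]) (use PS cone_in[OF B] const gB in \<open>auto\<close>)
  have "(\<lambda>n. (1 / real (Suc n)) *\<^sub>R (B + (- real (Suc n)) *\<^sub>R P)) \<longlonglongrightarrow> 0 *\<^sub>R B - P"
  proof -
    have "(\<lambda>n. (1 / real (Suc n)) *\<^sub>R B - P) \<longlonglongrightarrow> 0 *\<^sub>R B - P"
      by (intro tendsto_intros LIMSEQ_Suc lim_1_over_n)
    moreover have "(1 / real (Suc n)) *\<^sub>R (B + (- real (Suc n)) *\<^sub>R P) = (1 / real (Suc n)) *\<^sub>R B - P" for n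
      by (simp add: scaleR_right_diff_distrib del: of_nat_Suc)
    ultimately show ?thesis by simp
  qed
  moreover have "(1 / real (Suc n)) *\<^sub>R (B + (- real (Suc n)) *\<^sub>R P) \<in> \<Gamma>" for n
    by (intro cone_scale line) simp
  ultimately show ?thesis unfolding closure_sequential by (intro exI) auto
qed

text \<open>
  On the cone this is monotonicity in the directions \<open>P\<close> and \<open>- P\<close>. An arbitrary \<open>A\<close> is moved into the cone
  by adding a large multiple of \<open>e\<close>, and both sides are polynomials in that multiple.
\<close>

lemma edge_invariant:
  assumes P: "P \<in> closure \<Gamma>" "- P \<in> closure \<Gamma>" and PS: "P \<in> S" and A: "A \<in> S"
  shows "g (A + P) = g A"
proof -
  have inv: "g (B + P) = g B" if B: "B \<in> \<Gamma>" for B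
    using cone_in_closure_direction[OF B P(1) PS] cone_in_closure_direction(1)[OF _ P(2), of "B + P"] PS subspace
    by (simp add: subspace_neg)
  obtain q where q: "\<And>t. g (A + t *\<^sub>R e) = poly q t" using line_polynomial[OF A e_in] by blast
  obtain r where r: "\<And>t. g ((A + P) + t *\<^sub>R e) = poly r t"
    using line_polynomial[OF _ e_in, of "A + P"] A PS subspace by (auto simp: subspace_add)
  obtain \<rho> where \<rho>: "\<rho> > 0" "\<And>A. A \<in> S \<Longrightarrow> dist A e < \<rho> \<Longrightarrow> A \<in> \<Gamma>"
    using cone_nbhd[OF e_in_cone] by blast
  have far: "A + t *\<^sub>R e \<in> \<Gamma>" if t: "t > norm A / \<rho>" for t
  proof -
    have t0: "t > 0" using t \<rho>(1) by (smt (verit) divide_nonneg_pos norm_ge_zero)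
    have "dist ((1 / t) *\<^sub>R A + e) e < \<rho>" using t t0 \<rho>(1) by (simp add: dist_norm field_simps)
    then have "(1 / t) *\<^sub>R A + e \<in> \<Gamma>" using A e_in by (intro \<rho>(2)) auto
    from cone_scale[OF this t0] show ?thesis using t0 by (simp add: scaleR_right_distrib)
  qed
  have "poly (q - r) t = 0" if "t \<in> {norm A / \<rho><..}" for t
    using inv[OF far[of t]] q[of t] r[of t] that by (simp add: algebra_simps)
  then have "{norm A / \<rho><..} \<subseteq> {t. poly (q - r) t = 0}" by blast
  then have "infinite {t. poly (q - r) t = 0}" using infinite_Ioi finite_subset by blast
  then have "q - r = 0" using poly_roots_finite by blast
  then show ?thesis using q[of 0] r[of 0] by simp
qed

end

section \<open>Completeness and rank-one directions\<close>

lemma subspace_Sym2: "subspace (Sym2 V)"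
  unfolding Sym2_def subspace_def
  by (auto simp: transpose_def vec_eq_iff matrix_vector_mult_add_rdistrib scaleR_matrix_vector_assoc[symmetric])

lemma closed_Sym2_UNIV: "closed (Sym2 UNIV :: (real^'n^'n) set)"
  by (rule closed_subspace[OF subspace_Sym2])

text \<open>
  The matrix \<open>x y^t + y x^t\<close>; in particular \<open>sym_product z z\<close> is twice the rank-one matrix \<open>z z^t\<close>.
\<close>

definition sym_product :: "real^'n \<Rightarrow> real^'n \<Rightarrow> real^'n^'n" where
  "sym_product x y = (\<chi> i j. x $ i * y $ j + y $ i * x $ j)"

lemma sym_product_mult_vec: "sym_product x y *v z = (y \<bullet> z) *\<^sub>R x + (x \<bullet> z) *\<^sub>R y"
  by (simp add: sym_product_def matrix_vector_mult_def vec_eq_iff inner_vec_def sum.distrib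
      sum_distrib_left algebra_simps)

lemma sym_product_in_Sym2: "sym_product x y \<in> Sym2 UNIV"
  by (simp add: Sym2_UNIV sym_product_def transpose_def vec_eq_iff)

lemma quad_form_sym_product: "quad_form (sym_product x y) z = 2 * (x \<bullet> z) * (y \<bullet> z)"
  by (simp add: quad_form_def sym_product_mult_vec inner_add_right inner_commute)

lemma sym_product_scale: "sym_product x (c *\<^sub>R y) = c *\<^sub>R sym_product x y"
  by (simp add: sym_product_def vec_eq_iff algebra_simps)

lemma sym_product_add: "sym_product x (y + y') = sym_product x y + sym_product x y'"
  by (simp add: sym_product_def vec_eq_iff algebra_simps)

lemma sym_product_diff: "sym_product x (y - y') = sym_product x y - sym_product x y'"
  by (simp add: sym_product_def vec_eq_iff algebra_simps)

lemma sym_product_minus: "sym_product x (- y) = - sym_product x y"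
  by (simp add: sym_product_def vec_eq_iff)

lemma quad_form_add: "quad_form (A + B) x = quad_form A x + quad_form B x"
  and quad_form_diff: "quad_form (A - B) x = quad_form A x - quad_form B x"
  and quad_form_scale: "quad_form (c *\<^sub>R A) x = c * quad_form A x"
  and quad_form_mat_1: "quad_form (mat 1) x = x \<bullet> x"
  by (simp_all add: quad_form_def matrix_vector_mult_add_rdistrib matrix_vector_mult_diff_rdistrib
      inner_add_right inner_diff_right scaleR_matrix_vector_assoc[symmetric])

lemma continuous_on_sym_product [continuous_intros]:
  "continuous_on T f \<Longrightarrow> continuous_on T h \<Longrightarrow> continuous_on T (\<lambda>x. sym_product (f x) (h x))"
  unfolding sym_product_def by (intro continuous_intros)

lemma mat_1_in_Sym2: "mat 1 \<in> Sym2 UNIV"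
  by (simp add: Sym2_UNIV)

text \<open>
  The compression of \<open>A\<close> to the hyperplane orthogonal to \<open>z\<close>, that is \<open>Q A Q\<close> for the orthogonal projection
  \<open>Q\<close>. It is written as \<open>A - (z v^t + v z^t)\<close> so that invariance under the
  lineality space applies in one step.
\<close>

definition orthogonal_reduction :: "real^'n \<Rightarrow> real^'n^'n \<Rightarrow> real^'n^'n" where
  "orthogonal_reduction z A =
     A - sym_product z ((1 / (z \<bullet> z)) *\<^sub>R (A *v z) - (quad_form A z / (2 * (z \<bullet> z)\<^sup>2)) *\<^sub>R z)"

lemma orthogonal_comp_hyperplane:
  fixes z :: "real^'n"
  shows "orthogonal_comp (orthogonal_comp {z}) = span {z}"
proof -
  have "orthogonal_comp {z} = orthogonal_comp (span {z})"
    by (auto simp: orthogonal_comp_def orthogonal_def span_singleton)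
  then show ?thesis by (simp add: orthogonal_comp_self)
qed

lemma form_restr_orthogonal_comp:
  fixes z :: "real^'n"
  assumes z: "z \<noteq> 0" and A: "A \<in> Sym2 UNIV"
  shows "form_restr (orthogonal_comp {z}) A = orthogonal_reduction z A"
proof -
  define v where "v = (1 / (z \<bullet> z)) *\<^sub>R (A *v z) - (quad_form A z / (2 * (z \<bullet> z)\<^sup>2)) *\<^sub>R z"
  have R: "orthogonal_reduction z A = A - sym_product z v" by (simp add: orthogonal_reduction_def v_def)
  have zz: "z \<bullet> z \<noteq> 0" using z by simp
  have vz: "v \<bullet> z = quad_form A z / (2 * (z \<bullet> z))"
  proof -
    have "v \<bullet> z = (1 / (z \<bullet> z)) * quad_form A z - (quad_form A z / (2 * (z \<bullet> z)\<^sup>2)) * (z \<bullet> z)"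
      by (simp only: v_def inner_diff_left inner_scaleR_left quad_form_def inner_commute[of "A *v z" z])
    also have "\<dots> = quad_form A z / (2 * (z \<bullet> z))"
      using zz by (simp add: power2_eq_square field_simps)
    finally show ?thesis .
  qed
  have "(z \<bullet> z) *\<^sub>R v = A *v z - (quad_form A z / (2 * (z \<bullet> z))) *\<^sub>R z"
    using zz by (simp add: v_def scaleR_diff_right power2_eq_square)
  then have Rz: "orthogonal_reduction z A *v z = 0"
    by (simp add: R matrix_vector_mult_diff_rdistrib sym_product_mult_vec vz)
  have Rsym: "orthogonal_reduction z A \<in> Sym2 UNIV"
    unfolding R by (intro subspace_diff[OF subspace_Sym2] A sym_product_in_Sym2)
  have "orthogonal_reduction z A *v x = 0" if "x \<in> orthogonal_comp (orthogonal_comp {z})" for x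
    using that Rz unfolding orthogonal_comp_hyperplane
    by (auto simp: span_singleton matrix_vector_mult_scaleR)
  then have R1: "orthogonal_reduction z A \<in> Sym2 (orthogonal_comp {z})"
    using Rsym by (simp add: Sym2_def)
  have R2: "quad_form (orthogonal_reduction z A) x = quad_form A x" if "x \<in> orthogonal_comp {z}" for x
    using that by (simp add: R quad_form_diff quad_form_sym_product orthogonal_comp_def orthogonal_def)
  show ?thesis unfolding form_restr_def
    by (rule the1_equality[OF ex1_form_restr[OF subspace_orthogonal_comp]])
      (use A R1 R2 in \<open>auto simp: Sym2_UNIV\<close>)
qed

lemma form_restr_Sym2:
  assumes V: "subspace V" and A: "A \<in> Sym2 V"
  shows "form_restr V A = A"
  unfolding form_restr_def
  by (rule the1_equality[OF ex1_form_restr[OF V]]) (use A in \<open>auto simp: Sym2_def\<close>)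

lemma linear_orthogonal_reduction: "linear (orthogonal_reduction z)"
proof (rule linearI)
  show "orthogonal_reduction z (A + B) = orthogonal_reduction z A + orthogonal_reduction z B" for A B
    by (simp add: orthogonal_reduction_def matrix_vector_mult_add_rdistrib quad_form_add
        add_divide_distrib scaleR_add_left scaleR_add_right sym_product_diff sym_product_add)
  show "orthogonal_reduction z (c *\<^sub>R A) = c *\<^sub>R orthogonal_reduction z A" for c A
    by (simp add: orthogonal_reduction_def quad_form_scale scaleR_matrix_vector_assoc[symmetric]
        sym_product_diff sym_product_scale scaleR_diff_right mult.assoc mult.left_commute)
qed

lemma Sym2_mono: "Sym2 V \<subseteq> Sym2 UNIV"
  by (auto simp: Sym2_def)

lemma hyperbolic_polynomial_of_garding_dirichlet:
  fixes g :: "real^'n^'n \<Rightarrow> real"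
  assumes "garding_dirichlet UNIV N g"
  shows "hyperbolic_polynomial (Sym2 UNIV) g N (mat 1)"
  using assms mat_1_in_Sym2
  by unfold_locales
    (auto simp: garding_dirichlet_def homogeneous_polynomial_on_def form_restr_UNIV
      Sym2_UNIV[symmetric] real_rooted_def intro: subspace_Sym2)

locale dirichlet_garding =
  fixes g :: "real^'n^'n \<Rightarrow> real" and N :: nat
  assumes dirichlet: "garding_dirichlet UNIV N g"
begin

sublocale hyperbolic_polynomial "Sym2 UNIV" g N "mat 1"
  by (rule hyperbolic_polynomial_of_garding_dirichlet[OF dirichlet])

lemma garding_cone_eq: "garding_cone UNIV g = \<Gamma>"
  by (simp add: garding_cone_def \<Gamma>_def form_restr_UNIV)

lemma psd_in_closure_cone:
  assumes "A \<in> Sym2 UNIV" "\<And>x. quad_form A x \<ge> 0"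
  shows "A \<in> closure \<Gamma>"
  using dirichlet assms by (auto simp: garding_dirichlet_def garding_cone_eq)

text \<open>
  For \<open>\<epsilon> > 0\<close> the matrix \<open>(z + \<epsilon> v) (z + \<epsilon> v)^t\<close> lies in the closed cone and stays there when
  \<open>z z^t\<close> is subtracted. Dividing by \<open>\<epsilon>\<close> and letting \<open>\<epsilon>\<close> tend to \<open>0\<close> leaves \<open>z v^t + v z^t\<close>.
\<close>

lemma sym_product_in_edge:
  assumes edge: "- sym_product z z \<in> closure \<Gamma>"
  shows "sym_product z v \<in> closure \<Gamma>"
proof -
  define Q where "Q \<epsilon> = sym_product z v + (\<epsilon> / 2) *\<^sub>R sym_product v v" for \<epsilon> :: real
  have Q: "Q \<epsilon> \<in> closure \<Gamma>" if "\<epsilon> > 0" for \<epsilon>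
  proof -
    have "sym_product (z + \<epsilon> *\<^sub>R v) (z + \<epsilon> *\<^sub>R v) \<in> closure \<Gamma>"
      by (intro psd_in_closure_cone sym_product_in_Sym2) (simp add: quad_form_sym_product mult.assoc)
    then have "(1 / (2 * \<epsilon>)) *\<^sub>R (sym_product (z + \<epsilon> *\<^sub>R v) (z + \<epsilon> *\<^sub>R v) + - sym_product z z) \<in> closure \<Gamma>"
      using edge that by (intro closure_cone_scale closure_cone_add) auto
    moreover have "sym_product (z + \<epsilon> *\<^sub>R v) (z + \<epsilon> *\<^sub>R v) + - sym_product z z = (2 * \<epsilon>) *\<^sub>R Q \<epsilon>"
      by (simp add: Q_def sym_product_def vec_eq_iff algebra_simps)
    ultimately show ?thesis using that by simp
  qed
  have "(\<lambda>n. Q (1 / real (Suc n))) \<longlonglongrightarrow> sym_product z v + (0 / 2) *\<^sub>R sym_product v v"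
    unfolding Q_def by (intro tendsto_intros LIMSEQ_Suc lim_1_over_n) simp
  then have "sym_product z v + (0 / 2) *\<^sub>R sym_product v v \<in> closure \<Gamma>"
    by (rule Lim_in_closed_set[OF closed_closure always_eventually trivial_limit_sequentially, rotated])
      (intro allI Q, simp)
  then show ?thesis by simp
qed

lemma invariant_orthogonal_reduction:
  assumes edge: "- sym_product z z \<in> closure \<Gamma>" and A: "A \<in> Sym2 UNIV"
  shows "g (orthogonal_reduction z A) = g A"
proof -
  define v where "v = (1 / (z \<bullet> z)) *\<^sub>R (A *v z) - (quad_form A z / (2 * (z \<bullet> z)\<^sup>2)) *\<^sub>R z"
  have "sym_product z (- v) \<in> closure \<Gamma>" "- sym_product z (- v) \<in> closure \<Gamma>"
    using sym_product_in_edge[OF edge, of "- v"] sym_product_in_edge[OF edge, of v]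
    by (simp_all add: sym_product_minus)
  from edge_invariant[OF this sym_product_in_Sym2 A] show ?thesis
    by (simp add: orthogonal_reduction_def v_def[symmetric] sym_product_minus)
qed

text \<open>
  The operator itself serves as the polynomial on the hyperplane \<open>V\<close>: it agrees with its composition with the
  restriction to \<open>V\<close>. The restriction maps \<open>\<Gamma>\<close> into the Garding cone of \<open>V\<close>, because images of connected
  sets are connected, which yields the condition on nonnegative forms.
\<close>

lemma incomplete_if_edge:
  assumes z: "z \<noteq> 0" and edge: "- sym_product z z \<in> closure \<Gamma>"
  shows "\<not> complete_operator g"
proof -
  define V where "V = orthogonal_comp {z}"
  have V: "subspace V" by (simp add: V_def subspace_orthogonal_comp)
  have restr: "form_restr V A = orthogonal_reduction z A" if "A \<in> Sym2 UNIV" for A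
    unfolding V_def by (rule form_restr_orthogonal_comp[OF z that])
  have gR: "g (form_restr V A) = g A" if "A \<in> Sym2 UNIV" for A
    using invariant_orthogonal_reduction[OF edge that] restr[OF that] by simp
  have RV: "form_restr V A \<in> Sym2 V" if "A \<in> Sym2 UNIV" for A
    using theI'[OF ex1_form_restr[OF V, of A]] that by (simp add: form_restr_def Sym2_UNIV)
  interpret R: linear "orthogonal_reduction z" by (rule linear_orthogonal_reduction)
  have cont: "continuous_on T (orthogonal_reduction z)" for T
    by (rule linear_continuous_on) (simp add: linear_conv_bounded_linear[symmetric] linear_orthogonal_reduction)
  have "garding_dirichlet V N g"
    unfolding garding_dirichlet_def
  proof (intro conjI ballI)
    show "1 \<le> N" using dirichlet by (simp add: garding_dirichlet_def)
    show "homogeneous_polynomial_on (Sym2 V) N g"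
      using dirichlet Sym2_mono[of V] unfolding garding_dirichlet_def homogeneous_polynomial_on_def
      by (meson subsetD)
    show "0 < g (form_restr V (mat 1))" using gR[OF mat_1_in_Sym2] e_pos by simp
    show "\<exists>q :: real poly. (\<forall>t. poly q t = g (t *\<^sub>R form_restr V (mat 1) + A)) \<and>
      (\<forall>z :: complex. poly (map_poly of_real q) z = 0 \<longrightarrow> z \<in> \<real>)" if A: "A \<in> Sym2 V" for A
    proof -
      have A': "A \<in> Sym2 UNIV" using A Sym2_mono by blast
      have "orthogonal_reduction z A = A" using restr[OF A'] form_restr_Sym2[OF V A] by simp
      then have "t *\<^sub>R form_restr V (mat 1) + A = form_restr V (t *\<^sub>R mat 1 + A)" for t
        using restr[OF mat_1_in_Sym2] restr[OF comb_in(2)[OF mat_1_in_Sym2 A']] by (simp add: R.add R.scale)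
      then have "g (t *\<^sub>R form_restr V (mat 1) + A) = g (t *\<^sub>R mat 1 + A)" for t
        using gR[OF comb_in(2)[OF mat_1_in_Sym2 A']] by simp
      then show ?thesis using real_roots[OF A'] by (simp add: real_rooted_def)
    qed
    show "{A \<in> Sym2 V. \<forall>x\<in>V. 0 \<le> quad_form A x} \<subseteq> closure (garding_cone V g)"
    proof safe
      fix A assume A: "A \<in> Sym2 V" and psd: "\<forall>x\<in>V. 0 \<le> quad_form A x"
      have A': "A \<in> Sym2 UNIV" using A Sym2_mono by blast
      have "z \<in> orthogonal_comp V" unfolding V_def by (simp add: orthogonal_comp_hyperplane span_base)
      then have Az: "A *v z = 0" using A by (simp add: Sym2_def)
      have "quad_form A x \<ge> 0" for x
      proof -
        define y where "y = x - ((z \<bullet> x) / (z \<bullet> z)) *\<^sub>R z"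
        have "y \<in> V" using z by (simp add: y_def V_def orthogonal_comp_def orthogonal_def inner_diff_right)
        moreover have "A *v y = A *v x"
          by (simp add: y_def matrix_vector_mult_diff_distrib matrix_vector_mult_scaleR Az)
        moreover have "z \<bullet> (A *v x) = 0" using A' Az symmetric_inner[of A z x] by (simp add: Sym2_UNIV)
        ultimately have "quad_form A y = quad_form A x"
          by (simp add: quad_form_def) (simp add: y_def inner_diff_left)
        then show ?thesis using psd \<open>y \<in> V\<close> by metis
      qed
      then have "A \<in> closure \<Gamma>" by (intro psd_in_closure_cone A')
      moreover have "orthogonal_reduction z ` closure \<Gamma> \<subseteq> closure (orthogonal_reduction z ` \<Gamma>)"
        by (intro image_closure_subset cont) (auto intro: closure_subset[THEN subsetD])
      moreover have "orthogonal_reduction z A = A" using restr[OF A'] form_restr_Sym2[OF V A] by simp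
      ultimately have "A \<in> closure (orthogonal_reduction z ` \<Gamma>)" by force
      moreover have "orthogonal_reduction z ` \<Gamma> \<subseteq> garding_cone V g"
        unfolding garding_cone_def
      proof (rule connected_component_maximal)
        show "form_restr V (mat 1) \<in> orthogonal_reduction z ` \<Gamma>"
          using restr[OF mat_1_in_Sym2] e_in_cone by simp
        show "connected (orthogonal_reduction z ` \<Gamma>)"
          by (intro connected_continuous_image cont) (simp add: \<Gamma>_def)
        show "orthogonal_reduction z ` \<Gamma> \<subseteq> {A \<in> Sym2 V. g A \<noteq> 0}"
        proof safe
          fix B assume B: "B \<in> \<Gamma>"
          note S = cone_in[OF B]
          show "orthogonal_reduction z B \<in> Sym2 V" using RV[OF S] restr[OF S] by simp
          assume "g (orthogonal_reduction z B) = 0"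
          then show False using gR[OF S] restr[OF S] cone_pos[OF B] by simp
        qed
      qed
      ultimately show "A \<in> closure (garding_cone V g)" using closure_mono by blast
    qed
  qed
  moreover have "V \<noteq> UNIV"
  proof
    assume "V = UNIV"
    then have "z \<in> V" by simp
    then show False using z by (simp add: V_def orthogonal_comp_def orthogonal_def)
  qed
  moreover have "\<forall>A\<in>Sym2 UNIV. g A = g (form_restr V A)" using gR by simp
  ultimately have "\<exists>V h M. subspace V \<and> V \<noteq> UNIV \<and> garding_dirichlet V M h \<and>
      (\<forall>A\<in>Sym2 UNIV. g A = h (form_restr V A))"
    using V by (intro exI conjI) auto
  then show ?thesis by (simp only: complete_operator_def not_not)
qed

lemma unbounded_in_rank_one_direction:
  assumes "complete_operator g" and B: "B \<in> \<Gamma>" and z: "z \<noteq> 0"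
  shows "\<exists>t\<ge>0. g (B + t *\<^sub>R sym_product z z) > M"
proof (rule ccontr)
  assume "\<not> ?thesis"
  then have "\<And>t. t \<ge> 0 \<Longrightarrow> g (B + t *\<^sub>R sym_product z z) \<le> M" by (auto simp: not_less)
  moreover have "sym_product z z \<in> closure \<Gamma>"
    by (intro psd_in_closure_cone sym_product_in_Sym2) (simp add: quad_form_sym_product mult.assoc)
  ultimately have "- sym_product z z \<in> closure \<Gamma>"
    by (intro bounded_direction_in_edge[OF B _ sym_product_in_Sym2])
  then show False using incomplete_if_edge[OF z] assms(1) by blast
qed

end

section \<open>Calculus and geometry for the maximum principle\<close>

lemma has_derivative_gradient:
  fixes u :: "real^'n \<Rightarrow> real"
  assumes "u differentiable (at x)"
  shows "(u has_derivative (\<lambda>h. gradient u x \<bullet> h)) (at x)"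
proof -
  let ?D = "frechet_derivative u (at x)"
  have D: "(u has_derivative ?D) (at x)" using assms by (simp add: frechet_derivative_works)
  interpret D: bounded_linear ?D using D by (rule has_derivative_bounded_linear)
  have "?D h = gradient u x \<bullet> h" for h
  proof -
    have "?D h = ?D (\<Sum>i\<in>UNIV. (h $ i) *\<^sub>R axis i 1)"
      using basis_expansion[of h] by (simp add: scalar_mult_eq_scaleR)
    also have "\<dots> = (\<Sum>i\<in>UNIV. h $ i * ?D (axis i 1))" by (simp add: D.sum D.scaleR)
    also have "\<dots> = gradient u x \<bullet> h" by (simp add: gradient_def inner_vec_def mult.commute)
    finally show ?thesis .
  qed
  then have "?D = (\<lambda>h. gradient u x \<bullet> h)" by blast
  then show ?thesis using D by simp
qed

lemma has_derivative_hessian: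
  fixes u :: "real^'n \<Rightarrow> real"
  assumes "gradient u differentiable (at x)"
  shows "(gradient u has_derivative (\<lambda>h. hessian u x *v h)) (at x)"
proof -
  let ?D = "frechet_derivative (gradient u) (at x)"
  have D: "(gradient u has_derivative ?D) (at x)" using assms by (simp add: frechet_derivative_works)
  have "linear ?D" using has_derivative_bounded_linear[OF D] by (rule bounded_linear.linear)
  then have "hessian u x *v h = ?D h" for h
    unfolding hessian_def by (intro matrix_works) (simp add: linear_matrix_vector_mul_eq)
  then show ?thesis using D by simp
qed

lemma has_derivative_unique_gradient:
  fixes u :: "real^'n \<Rightarrow> real"
  assumes "(u has_derivative (\<lambda>h. G \<bullet> h)) (at x)"
  shows "gradient u x = G"
  using frechet_derivative_at[OF assms, symmetric] by (simp add: gradient_def inner_axis)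

lemma C2_on_line_derivatives:
  assumes C2: "C2_on X u"
  shows "x + t *\<^sub>R \<xi> \<in> X \<Longrightarrow>
      ((\<lambda>t. u (x + t *\<^sub>R \<xi>)) has_real_derivative gradient u (x + t *\<^sub>R \<xi>) \<bullet> \<xi>) (at t)"
    and "x \<in> X \<Longrightarrow> ((\<lambda>t. gradient u (x + t *\<^sub>R \<xi>) \<bullet> \<xi>) has_real_derivative quad_form (hessian u x) \<xi>) (at 0)"
proof -
  have line: "((\<lambda>t. x + t *\<^sub>R \<xi>) has_derivative (\<lambda>h. h *\<^sub>R \<xi>)) (at t)" for t
    by (auto intro!: derivative_eq_intros)
  show "((\<lambda>t. u (x + t *\<^sub>R \<xi>)) has_real_derivative gradient u (x + t *\<^sub>R \<xi>) \<bullet> \<xi>) (at t)"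
    if "x + t *\<^sub>R \<xi> \<in> X"
  proof -
    have "((\<lambda>t. u (x + t *\<^sub>R \<xi>)) has_derivative (\<lambda>h. gradient u (x + t *\<^sub>R \<xi>) \<bullet> (h *\<^sub>R \<xi>))) (at t)"
      using C2 that by (intro has_derivative_compose[OF line has_derivative_gradient]) (auto simp: C2_on_def)
    then show ?thesis by (simp add: has_field_derivative_def mult.commute[of _ "gradient u _ \<bullet> \<xi>"])
  qed
  show "((\<lambda>t. gradient u (x + t *\<^sub>R \<xi>) \<bullet> \<xi>) has_real_derivative quad_form (hessian u x) \<xi>) (at 0)"
    if "x \<in> X"
  proof -
    have "(gradient u has_derivative (\<lambda>h. hessian u x *v h)) (at (x + 0 *\<^sub>R \<xi>))"
      using C2 that by (auto simp: C2_on_def intro: has_derivative_hessian)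
    from has_derivative_compose[OF line this]
    have "((\<lambda>t. gradient u (x + t *\<^sub>R \<xi>) \<bullet> \<xi>) has_derivative (\<lambda>h. (hessian u x *v (h *\<^sub>R \<xi>)) \<bullet> \<xi>)) (at 0)"
      by (rule has_derivative_inner_left)
    then show ?thesis
      by (simp add: has_field_derivative_def quad_form_def matrix_vector_mult_scaleR inner_commute
          mult.commute[of _ "\<xi> \<bullet> (hessian u x *v \<xi>)"])
  qed
qed

lemma second_derivative_at_local_max:
  fixes \<phi> :: "real \<Rightarrow> real"
  assumes \<delta>: "\<delta> > 0" and d1: "\<And>t. \<bar>t\<bar> < \<delta> \<Longrightarrow> (\<phi> has_real_derivative \<psi> t) (at t)"
    and d2: "(\<psi> has_real_derivative D) (at 0)" and max: "\<And>t. \<bar>t\<bar> < \<delta> \<Longrightarrow> \<phi> t \<le> \<phi> 0"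
  shows "D \<le> 0"
proof (rule ccontr)
  assume "\<not> D \<le> 0"
  then obtain d where d: "d > 0" "\<And>h. 0 < h \<Longrightarrow> h < d \<Longrightarrow> \<psi> 0 < \<psi> (0 + h)"
    using DERIV_pos_inc_right[OF d2] by auto
  have \<psi>0: "\<psi> 0 = 0"
    by (rule DERIV_local_max[OF d1[of 0] \<delta>]) (use \<delta> max in auto)
  define b where "b = min d \<delta> / 2"
  have b: "0 < b" "b < d" "b < \<delta>" using d(1) \<delta> by (auto simp: b_def)
  obtain c where c: "0 < c" "c < b" "\<phi> b - \<phi> 0 = (b - 0) * \<psi> c"
    using MVT2[OF b(1), of \<phi> \<psi>] d1 b by (smt (verit))
  then have "\<phi> b - \<phi> 0 > 0" using d(2)[of c] b \<psi>0 by simp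
  then show False using max[of b] b by simp
qed

lemma gaussian_line_derivatives:
  fixes z \<xi> :: "'a::real_inner" and \<alpha> :: real
  defines "\<psi> \<equiv> \<lambda>t. exp (- \<alpha> * (norm (z + t *\<^sub>R \<xi>))\<^sup>2) * (- 2 * \<alpha> * (z \<bullet> \<xi> + t * (\<xi> \<bullet> \<xi>)))"
  shows "((\<lambda>t. exp (- \<alpha> * (norm (z + t *\<^sub>R \<xi>))\<^sup>2)) has_real_derivative \<psi> t) (at t)"
    and "(\<psi> has_real_derivative
      exp (- \<alpha> * (norm z)\<^sup>2) * (4 * \<alpha>\<^sup>2 * (z \<bullet> \<xi>)\<^sup>2 - 2 * \<alpha> * (\<xi> \<bullet> \<xi>))) (at 0)"
proof -
  have eq: "(norm (z + t *\<^sub>R \<xi>))\<^sup>2 = z \<bullet> z + 2 * t * (z \<bullet> \<xi>) + t\<^sup>2 * (\<xi> \<bullet> \<xi>)" for t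
    unfolding power2_norm_eq_inner
    by (simp add: inner_add_left inner_add_right inner_commute power2_eq_square algebra_simps)
  show "((\<lambda>t. exp (- \<alpha> * (norm (z + t *\<^sub>R \<xi>))\<^sup>2)) has_real_derivative \<psi> t) (at t)"
    unfolding \<psi>_def eq by (auto intro!: derivative_eq_intros simp: algebra_simps)
  show "(\<psi> has_real_derivative
      exp (- \<alpha> * (norm z)\<^sup>2) * (4 * \<alpha>\<^sup>2 * (z \<bullet> \<xi>)\<^sup>2 - 2 * \<alpha> * (\<xi> \<bullet> \<xi>))) (at 0)"
    unfolding \<psi>_def eq power2_norm_eq_inner
    by (auto intro!: derivative_eq_intros simp: algebra_simps power2_eq_square inner_commute[of \<xi> z])
qed

text \<open>
  The ball with diameter from \<open>q\<close> to \<open>x0\<close> touches the sphere about \<open>q\<close> through \<open>x0\<close> only at \<open>x0\<close>, by the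
  parallelogram law.
\<close>

lemma dist_less_outside_internally_tangent_ball:
  fixes q x0 x :: "'a::real_inner"
  assumes "dist x (midpoint q x0) \<le> dist q x0 / 2" "x \<noteq> x0"
  shows "dist q x < dist q x0"
proof -
  define a b where "a = x - midpoint q x0" and "b = midpoint q x0 - q"
  have b: "midpoint q x0 - q = x0 - midpoint q x0"
    using midpoint_plus_self[of q x0] by (simp add: algebra_simps)
  have nb: "norm b = dist q x0 / 2"
    unfolding b_def dist_norm[symmetric] by (metis dist_commute dist_midpoint(1))
  have ab: "a + b = x - q" "a - b = x - x0" by (simp add: a_def b_def, unfold a_def b_def b, simp)
  have "(norm (a + b))\<^sup>2 + (norm (a - b))\<^sup>2 = 2 * (norm a)\<^sup>2 + 2 * (norm b)\<^sup>2"
    by (simp add: power2_norm_eq_inner inner_add_left inner_add_right inner_diff_left inner_diff_right)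
  moreover have "(norm a)\<^sup>2 \<le> (norm b)\<^sup>2" unfolding nb
    using assms(1) by (intro power_mono) (auto simp: a_def dist_norm)
  moreover have "(norm b)\<^sup>2 = (dist q x0)\<^sup>2 / 4" by (simp add: nb power_divide)
  moreover have "(norm (a - b))\<^sup>2 > 0" using assms(2) by (simp add: ab)
  ultimately have "(norm (a + b))\<^sup>2 < (dist q x0)\<^sup>2" by linarith
  then have "(dist q x)\<^sup>2 < (dist q x0)\<^sup>2" by (simp add: ab dist_norm norm_minus_commute)
  then show ?thesis by (rule power2_less_imp_less) simp
qed

text \<open>
  Take \<open>x0\<close> as the point of the maximum set nearest to a point \<open>q\<close> outside it but close to one of its boundary
  points. The ball about \<open>q\<close> may touch the set at several points; passing to the ball with diameter from \<open>q\<close> to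
  \<open>x0\<close> leaves \<open>x0\<close> as the only contact.
\<close>

lemma tangent_ball_at_maximum:
  fixes w :: "'a::euclidean_space \<Rightarrow> real"
  assumes X: "open X" "connected X" and w: "continuous_on X w" and le: "\<And>x. x \<in> X \<Longrightarrow> w x \<le> M"
    and p: "p \<in> X" "w p = M" and q: "q \<in> X" "w q \<noteq> M"
  obtains y x0 where "x0 \<in> X" "x0 \<noteq> y" "w x0 = M"
    and "\<And>x. x \<in> X \<Longrightarrow> dist x y \<le> dist x0 y \<Longrightarrow> x \<noteq> x0 \<Longrightarrow> w x < M"
proof -
  define K where "K = {x \<in> X. w x = M}"
  have "closedin (top_of_set X) K"
    unfolding K_def using continuous_closedin_preimage_constant[OF w] by simp
  moreover have "K \<noteq> {}" "K \<noteq> X" using p q by (auto simp: K_def)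
  ultimately have "\<not> openin (top_of_set X) K" using X(2) unfolding connected_clopen by blast
  then have "\<not> open K" using X(1) by (auto simp: K_def openin_open_eq)
  then obtain p where p: "p \<in> K" "\<And>e. e > 0 \<Longrightarrow> \<not> ball p e \<subseteq> K" unfolding open_contains_ball by blast
  have pX: "p \<in> X" using p(1) by (simp add: K_def)
  obtain \<rho> where \<rho>: "\<rho> > 0" "cball p \<rho> \<subseteq> X" using X(1) pX unfolding open_contains_cball by blast
  have "\<not> ball p (\<rho> / 2) \<subseteq> K" using p(2)[of "\<rho> / 2"] \<rho>(1) by simp
  then obtain q where q: "q \<in> ball p (\<rho> / 2)" "q \<notin> K" by blast
  define K1 where "K1 = {x \<in> cball p \<rho>. w x = M}"
  have "closed K1" unfolding K1_def
    using \<rho>(2) w by (intro continuous_closed_preimage_constant closed_cball) (rule continuous_on_subset)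
  moreover have "bounded K1" by (rule bounded_subset[OF bounded_cball]) (auto simp: K1_def)
  ultimately have "compact K1" by (simp add: compact_eq_bounded_closed)
  moreover have "p \<in> K1" using p(1) \<rho>(1) by (auto simp: K1_def K_def)
  moreover have "continuous_on K1 (dist q)" by (intro continuous_intros)
  ultimately obtain x0 where x0: "x0 \<in> K1" "\<And>x. x \<in> K1 \<Longrightarrow> dist q x0 \<le> dist q x"
    using continuous_attains_inf[of K1 "dist q"] by (metis empty_iff)
  have x0X: "x0 \<in> X" "w x0 = M" using x0(1) \<rho>(2) by (auto simp: K1_def)
  have "q \<noteq> x0" using q(2) x0X by (auto simp: K_def)
  show ?thesis
  proof (rule that[of x0 "midpoint q x0"])
    show "x0 \<in> X" "w x0 = M" by fact+
    show "x0 \<noteq> midpoint q x0" using \<open>q \<noteq> x0\<close> by (metis midpoint_eq_endpoint(2))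
    fix x assume x: "x \<in> X" "dist x (midpoint q x0) \<le> dist x0 (midpoint q x0)" "x \<noteq> x0"
    have "dist x0 (midpoint q x0) = dist q x0 / 2" by (metis dist_midpoint(4) dist_commute)
    then have less: "dist q x < dist q x0" using x by (intro dist_less_outside_internally_tangent_ball) auto
    have "dist q x0 < \<rho> / 2" using x0(2)[OF \<open>p \<in> K1\<close>] q(1) by (simp add: dist_commute)
    then have "dist p x \<le> \<rho>" using less q(1) dist_triangle[of p x q] by simp
    then have "w x \<noteq> M" using x0(2)[of x] less by (auto simp: K1_def)
    then show "w x < M" using le[OF x(1)] by simp
  qed
qed

lemma C2_on_continuous: "C2_on X u \<Longrightarrow> continuous_on X u"
  by (auto simp: C2_on_def intro!: continuous_at_imp_continuous_on differentiable_imp_continuous_within)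

text \<open>
  The second derivative test along the line through \<open>x\<close> in direction \<open>\<xi>\<close>.
\<close>

lemma hessian_comparison_at_max:
  fixes u H :: "real^'n \<Rightarrow> real"
  assumes C2: "C2_on X u" "C2_on X H" and r: "ball x r \<subseteq> X" "r > 0"
    and max: "\<And>x'. x' \<in> ball x r \<Longrightarrow>
      u x' - H x' + \<epsilon> * exp (- \<alpha> * (norm (x' - y))\<^sup>2) \<le> u x - H x + \<epsilon> * exp (- \<alpha> * (norm (x - y))\<^sup>2)"
  shows "quad_form (hessian u x - hessian H x) \<xi> +
    \<epsilon> * (exp (- \<alpha> * (norm (x - y))\<^sup>2) * (4 * \<alpha>\<^sup>2 * ((x - y) \<bullet> \<xi>)\<^sup>2 - 2 * \<alpha> * (\<xi> \<bullet> \<xi>))) \<le> 0"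
proof -
  define \<delta> where "\<delta> = r / (norm \<xi> + 1)"
  have n: "norm \<xi> + 1 > 0" by (smt (verit) norm_ge_zero)
  have \<delta>: "\<delta> > 0" using r(2) n by (simp add: \<delta>_def)
  have near: "x + t *\<^sub>R \<xi> \<in> ball x r" if "\<bar>t\<bar> < \<delta>" for t
  proof -
    have "\<bar>t\<bar> * norm \<xi> \<le> \<bar>t\<bar> * (norm \<xi> + 1)" by (intro mult_left_mono) auto
    also have "\<dots> < r" using that n by (simp add: \<delta>_def field_simps)
    finally show ?thesis by (simp add: dist_norm)
  qed
  have x: "x \<in> X" using r by auto
  have shift: "x + t *\<^sub>R \<xi> - y = (x - y) + t *\<^sub>R \<xi>" for t by simp
  show ?thesis
    unfolding quad_form_diff
  proof (rule second_derivative_at_local_max[OF \<delta>])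
    show "((\<lambda>t. u (x + t *\<^sub>R \<xi>) - H (x + t *\<^sub>R \<xi>) + \<epsilon> * exp (- \<alpha> * (norm ((x - y) + t *\<^sub>R \<xi>))\<^sup>2)) has_real_derivative
        (gradient u (x + t *\<^sub>R \<xi>) \<bullet> \<xi> - gradient H (x + t *\<^sub>R \<xi>) \<bullet> \<xi> +
         \<epsilon> * (exp (- \<alpha> * (norm ((x - y) + t *\<^sub>R \<xi>))\<^sup>2) * (- 2 * \<alpha> * ((x - y) \<bullet> \<xi> + t * (\<xi> \<bullet> \<xi>)))))) (at t)"
      if "\<bar>t\<bar> < \<delta>" for t
      using near[OF that] r(1)
      by (intro DERIV_add DERIV_diff DERIV_cmult C2_on_line_derivatives(1)[OF C2(1)]
          C2_on_line_derivatives(1)[OF C2(2)] gaussian_line_derivatives(1)) auto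
    show "((\<lambda>t. gradient u (x + t *\<^sub>R \<xi>) \<bullet> \<xi> - gradient H (x + t *\<^sub>R \<xi>) \<bullet> \<xi> +
         \<epsilon> * (exp (- \<alpha> * (norm ((x - y) + t *\<^sub>R \<xi>))\<^sup>2) * (- 2 * \<alpha> * ((x - y) \<bullet> \<xi> + t * (\<xi> \<bullet> \<xi>)))))
       has_real_derivative quad_form (hessian u x) \<xi> - quad_form (hessian H x) \<xi> +
    \<epsilon> * (exp (- \<alpha> * (norm (x - y))\<^sup>2) * (4 * \<alpha>\<^sup>2 * ((x - y) \<bullet> \<xi>)\<^sup>2 - 2 * \<alpha> * (\<xi> \<bullet> \<xi>)))) (at 0)"
      by (intro DERIV_add DERIV_diff DERIV_cmult C2_on_line_derivatives(2)[OF C2(1) x]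
          C2_on_line_derivatives(2)[OF C2(2) x] gaussian_line_derivatives(2))
    show "u (x + t *\<^sub>R \<xi>) - H (x + t *\<^sub>R \<xi>) + \<epsilon> * exp (- \<alpha> * (norm ((x - y) + t *\<^sub>R \<xi>))\<^sup>2)
       \<le> u (x + 0 *\<^sub>R \<xi>) - H (x + 0 *\<^sub>R \<xi>) + \<epsilon> * exp (- \<alpha> * (norm ((x - y) + 0 *\<^sub>R \<xi>))\<^sup>2)"
      if "\<bar>t\<bar> < \<delta>" for t
      using max[OF near[OF that]] by (simp add: shift)
  qed
qed

section \<open>The strong comparison principle\<close>

lemma hessian_arg_diff: "hessian_arg k u x - hessian_arg k H x = hessian u x - hessian H x"
  by (cases k) auto

lemma continuous_on_hessian_arg: "C2_on X u \<Longrightarrow> continuous_on X (hessian_arg k u)"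
  by (cases k) (auto simp: C2_on_def intro!: continuous_intros)

lemma C2_solution_add_constant:
  fixes u H :: "real^'n \<Rightarrow> real"
  assumes X: "open X" and H: "C2_solution k g X f H" and u: "C2_on X u"
    and eq: "\<And>x. x \<in> X \<Longrightarrow> u x = H x + c"
  shows "C2_solution k g X f u"
proof -
  have C2H: "C2_on X H" using H by (simp add: C2_solution_def)
  have grad: "gradient u x = gradient H x" if x: "x \<in> X" for x
  proof (rule has_derivative_unique_gradient)
    have "((\<lambda>x. H x + c) has_derivative (\<lambda>h. gradient H x \<bullet> h)) (at x)"
      using has_derivative_gradient[of H x] C2H x by (auto simp: C2_on_def intro!: derivative_eq_intros)
    then show "(u has_derivative (\<lambda>h. gradient H x \<bullet> h)) (at x)"
      by (rule has_derivative_transform_within_open[OF _ X x]) (simp add: eq)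
  qed
  have "hessian u x = hessian H x" if x: "x \<in> X" for x
  proof -
    have "(gradient H has_derivative (\<lambda>h. hessian H x *v h)) (at x)"
      using has_derivative_hessian[of H x] C2H x by (auto simp: C2_on_def)
    then have "(gradient u has_derivative (\<lambda>h. hessian H x *v h)) (at x)"
      by (rule has_derivative_transform_within_open[OF _ X x]) (simp add: grad)
    from frechet_derivative_at[OF this, symmetric] show ?thesis
      by (simp add: hessian_def[of u] matrix_of_matrix_vector_mul)
  qed
  then have "hessian_arg k u x = hessian_arg k H x" if "x \<in> X" for x
    using that by (cases k) auto
  then show ?thesis using H u by (simp add: C2_solution_def)
qed

context dirichlet_garding
begin

lemma hessian_arg_in_cone:
  fixes f :: "real^'n \<Rightarrow> real"
  assumes "A \<in> closure (garding_cone UNIV g)" "g A \<ge> exp (f x)"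
  shows "A \<in> \<Gamma>"
proof (rule closure_cone_nonzero)
  show A: "A \<in> closure \<Gamma>" using assms(1) by (simp add: garding_cone_eq)
  have "closure \<Gamma> \<subseteq> Sym2 UNIV"
    by (rule closure_minimal) (auto intro: cone_in closed_Sym2_UNIV)
  then show "A \<in> Sym2 UNIV" using A by blast
  show "g A \<noteq> 0" using assms(2) exp_gt_zero[of "f x"] by linarith
qed

text \<open>
  The order of choices matters: \<open>s\<close> is fixed by openness of the cone at \<open>B x0\<close>, and then \<open>\<alpha>\<close> makes the rank-one
  part of the barrier's Hessian dominate, by completeness. The strict inequality at the single point \<open>x0\<close> spreads to
  a neighbourhood by continuity, which takes the place of a uniform ellipticity estimate.
\<close>

lemma strictly_increasing_barrier_direction:
  assumes complete: "complete_operator g" and X: "open X" "x0 \<in> X"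
    and B: "continuous_on X B" "\<And>x. x \<in> X \<Longrightarrow> B x \<in> \<Gamma>" and z: "x0 \<noteq> y"
  obtains s \<alpha> r where "s > 0" "\<alpha> > 0" "r > 0" "cball x0 r \<subseteq> X"
    and "\<And>x. x \<in> cball x0 r \<Longrightarrow> B x + s *\<^sub>R (\<alpha> *\<^sub>R sym_product (x - y) (x - y) - mat 1) \<in> \<Gamma> \<and>
      g (B x + s *\<^sub>R (\<alpha> *\<^sub>R sym_product (x - y) (x - y) - mat 1)) > g (B x)"
proof -
  note B0 = B(2)[OF X(2)]
  let ?z = "x0 - y"
  obtain \<rho> where \<rho>: "\<rho> > 0" "\<And>A. A \<in> Sym2 UNIV \<Longrightarrow> dist A (B x0) < \<rho> \<Longrightarrow> A \<in> \<Gamma>"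
    using cone_nbhd[OF B0] by blast
  define m where "m = norm (mat 1 :: real^'n^'n) + 1"
  define s where "s = \<rho> / (2 * m)"
  have m: "m > 0" unfolding m_def by (smt (verit) norm_ge_zero)
  have s: "s > 0" using \<rho>(1) m by (simp add: s_def)
  have "s * norm (mat 1 :: real^'n^'n) \<le> s * m"
    using s by (intro mult_left_mono) (auto simp: m_def)
  also have "\<dots> < \<rho>" using m \<rho>(1) by (simp add: s_def)
  finally have Bs: "B x0 - s *\<^sub>R mat 1 \<in> \<Gamma>"
    using s comb_in(1)[OF cone_in[OF B0] mat_1_in_Sym2, of "- s"] by (intro \<rho>(2)) (auto simp: dist_norm)
  obtain \<tau> where \<tau>: "\<tau> \<ge> 0" "g (B x0 - s *\<^sub>R mat 1 + \<tau> *\<^sub>R sym_product ?z ?z) > g (B x0)"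
    using unbounded_in_rank_one_direction[OF complete Bs, of ?z] z by auto
  have "g (B x0 - s *\<^sub>R mat 1) \<le> g (B x0 - s *\<^sub>R mat 1 + s *\<^sub>R mat 1)"
    by (rule increasing_in_cone_direction[OF Bs cone_scale[OF e_in_cone s]])
  then have "\<tau> \<noteq> 0" using \<tau>(2) by auto
  then have \<tau>0: "\<tau> > 0" using \<tau>(1) by simp
  define \<alpha> where "\<alpha> = \<tau> / s"
  define F where "F x = B x + s *\<^sub>R (\<alpha> *\<^sub>R sym_product (x - y) (x - y) - mat 1)" for x
  have F0: "F x0 = B x0 - s *\<^sub>R mat 1 + \<tau> *\<^sub>R sym_product ?z ?z"
    using s by (simp add: F_def \<alpha>_def algebra_simps)
  have "\<tau> *\<^sub>R sym_product ?z ?z \<in> Sym2 UNIV"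
    by (intro subspace_scale[OF subspace_Sym2] sym_product_in_Sym2)
  then have "F x0 \<in> \<Gamma>" unfolding F0 using \<tau>(1)
    by (intro cone_in_closure_direction(2)[OF Bs] psd_in_closure_cone)
      (auto simp: quad_form_scale quad_form_sym_product mult.assoc)
  then obtain \<sigma> where \<sigma>: "\<sigma> > 0" "\<And>A. A \<in> Sym2 UNIV \<Longrightarrow> dist A (F x0) < \<sigma> \<Longrightarrow> A \<in> \<Gamma>"
    using cone_nbhd by blast
  have FS: "F x \<in> Sym2 UNIV" if "x \<in> X" for x
    unfolding F_def using cone_in[OF B(2)[OF that]]
    by (intro comb_in subspace_diff[OF subspace_Sym2] subspace_scale[OF subspace_Sym2] sym_product_in_Sym2 mat_1_in_Sym2)
  have contF: "continuous_on X F" unfolding F_def by (intro continuous_intros B(1))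
  have contg: "continuous_on X (\<lambda>x. g (F x) - g (B x))"
    using FS cone_in[OF B(2)]
    by (intro continuous_intros continuous_on_compose2[OF continuous_on_S contF]
        continuous_on_compose2[OF continuous_on_S B(1)]) auto
  obtain d1 where d1: "d1 > 0" "\<And>x. x \<in> X \<Longrightarrow> dist x x0 < d1 \<Longrightarrow> dist (F x) (F x0) < \<sigma>"
    using contF X(2) \<sigma>(1) unfolding continuous_on_iff by blast
  have gap: "g (F x0) - g (B x0) > 0" using \<tau>(2) by (simp add: F0)
  then obtain d2 where d2: "d2 > 0" "\<And>x. x \<in> X \<Longrightarrow> dist x x0 < d2 \<Longrightarrow>
      dist (g (F x) - g (B x)) (g (F x0) - g (B x0)) < g (F x0) - g (B x0)"
    using contg X(2) unfolding continuous_on_iff by blast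
  obtain d3 where d3: "d3 > 0" "cball x0 d3 \<subseteq> X" using X unfolding open_contains_cball by blast
  define r where "r = min (min d1 d2 / 2) d3"
  have r: "r > 0" "r \<le> d3" "r < d1" "r < d2" using d1(1) d2(1) d3(1) by (auto simp: r_def)
  show ?thesis
  proof (rule that[OF s _ r(1)])
    show "\<alpha> > 0" using \<tau>0 s by (simp add: \<alpha>_def)
    show sub: "cball x0 r \<subseteq> X" using r(2) d3(2) by (meson subset_cball subset_trans)
    fix x assume x: "x \<in> cball x0 r"
    then have xX: "x \<in> X" and xd: "dist x x0 < d1" "dist x x0 < d2" using sub r by (auto simp: dist_commute)
    have "F x \<in> \<Gamma>" by (intro \<sigma>(2) FS xX d1(2) xd)
    moreover have "g (F x) > g (B x)" using d2(2)[OF xX xd(2)] by (auto simp: dist_real_def abs_if split: if_splits)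
    ultimately show "B x + s *\<^sub>R (\<alpha> *\<^sub>R sym_product (x - y) (x - y) - mat 1) \<in> \<Gamma> \<and>
      g (B x + s *\<^sub>R (\<alpha> *\<^sub>R sym_product (x - y) (x - y) - mat 1)) > g (B x)"
      unfolding F_def by blast
  qed
qed

text \<open>
  On the sphere of radius \<open>r\<close> about \<open>x0\<close>, the function \<open>u - H\<close> is below \<open>M\<close> by a fixed amount inside the
  touching ball, and the barrier is smaller than at \<open>x0\<close> outside of it. Therefore the perturbed function
  has its maximum over the closed ball at an interior point, where the comparison of Hessians contradicts
  concavity.
\<close>

lemma no_tangent_ball_at_maximum:
  assumes complete: "complete_operator g" and X: "open X"
    and C2: "C2_on X u" "C2_on X H"
    and A: "\<And>x. x \<in> X \<Longrightarrow> hessian_arg k u x \<in> \<Gamma>"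
    and B: "\<And>x. x \<in> X \<Longrightarrow> hessian_arg k H x \<in> \<Gamma>"
    and gAB: "\<And>x. x \<in> X \<Longrightarrow> g (hessian_arg k H x) \<le> g (hessian_arg k u x)"
    and x0: "x0 \<in> X" "x0 \<noteq> y" "u x0 - H x0 = M"
    and le: "\<And>x. x \<in> X \<Longrightarrow> u x - H x \<le> M"
    and less: "\<And>x. x \<in> X \<Longrightarrow> dist x y \<le> dist x0 y \<Longrightarrow> x \<noteq> x0 \<Longrightarrow> u x - H x < M"
  shows False
proof -
  define w where "w x = u x - H x" for x
  obtain s \<alpha> r where s: "s > 0" and \<alpha>: "\<alpha> > 0" and r: "r > 0" "cball x0 r \<subseteq> X"
    and fwd: "\<And>x. x \<in> cball x0 r \<Longrightarrow>
      hessian_arg k H x + s *\<^sub>R (\<alpha> *\<^sub>R sym_product (x - y) (x - y) - mat 1) \<in> \<Gamma> \<and>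
      g (hessian_arg k H x + s *\<^sub>R (\<alpha> *\<^sub>R sym_product (x - y) (x - y) - mat 1)) > g (hessian_arg k H x)"
    using strictly_increasing_barrier_direction[OF complete X x0(1)
        continuous_on_hessian_arg[OF C2(2)] B x0(2)] by blast
  have cont_w: "continuous_on T w" if "T \<subseteq> X" for T
    unfolding w_def
    by (intro continuous_intros continuous_on_subset[OF C2_on_continuous[OF C2(1)] that]
        continuous_on_subset[OF C2_on_continuous[OF C2(2)] that])
  define v where "v x = exp (- \<alpha> * (norm (x - y))\<^sup>2)" for x
  obtain \<delta> where \<delta>: "\<delta> > 0" "\<And>x. x \<in> sphere x0 r \<Longrightarrow> dist x y \<le> dist x0 y \<Longrightarrow> w x \<le> M - \<delta>"
  proof (cases "sphere x0 r \<inter> cball y (dist x0 y) = {}")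
    case True
    then have "x \<notin> sphere x0 r" if "dist x y \<le> dist x0 y" for x using that by (auto simp: dist_commute)
    then show ?thesis using that[of 1] by fastforce
  next
    case False
    have sub: "sphere x0 r \<inter> cball y (dist x0 y) \<subseteq> X" using r(2) by auto
    have "compact (sphere x0 r \<inter> cball y (dist x0 y))" by (intro compact_Int) auto
    then obtain m where m: "m \<in> sphere x0 r" "m \<in> cball y (dist x0 y)"
      "\<And>x. x \<in> sphere x0 r \<inter> cball y (dist x0 y) \<Longrightarrow> w x \<le> w m"
      using continuous_attains_sup[OF _ False cont_w[OF sub]] by blast
    have "w m < M" unfolding w_def using m(1,2) sub r(1) by (intro less) (auto simp: dist_commute)
    then show ?thesis using that[of "M - w m"] m(3) by (auto simp: dist_commute)
  qed
  define \<epsilon> where "\<epsilon> = \<delta> / 2"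
  have \<epsilon>: "\<epsilon> > 0" "\<epsilon> < \<delta>" using \<delta>(1) by (auto simp: \<epsilon>_def)
  define \<phi> where "\<phi> x = w x + \<epsilon> * v x" for x
  have "continuous_on (cball x0 r) \<phi>"
    unfolding \<phi>_def v_def by (intro continuous_intros cont_w r(2))
  then obtain x1 where x1: "x1 \<in> cball x0 r" "\<And>x. x \<in> cball x0 r \<Longrightarrow> \<phi> x \<le> \<phi> x1"
    using continuous_attains_sup[of "cball x0 r" \<phi>] r(1) by auto
  have x1X: "x1 \<in> X" using x1(1) r(2) by blast
  have "x1 \<notin> sphere x0 r"
  proof
    assume sph: "x1 \<in> sphere x0 r"
    have ge: "M + \<epsilon> * v x0 \<le> \<phi> x1" using x1(2)[of x0] r(1) x0(3) by (simp add: \<phi>_def w_def)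
    have v: "0 < v x" "v x \<le> 1" for x using \<alpha> by (auto simp: v_def)
    show False
    proof (cases "dist x1 y \<le> dist x0 y")
      case True
      then have "w x1 \<le> M - \<delta>" using \<delta>(2) sph by blast
      moreover have "\<epsilon> * v x1 \<le> \<epsilon>" using \<epsilon>(1) v(2)[of x1] by simp
      moreover have "\<epsilon> * v x0 > 0" using \<epsilon>(1) v(1) by simp
      ultimately show False using ge \<epsilon> unfolding \<phi>_def by linarith
    next
      case False
      then have "(norm (x0 - y))\<^sup>2 < (norm (x1 - y))\<^sup>2"
        by (intro power_strict_mono) (auto simp: dist_norm)
      then have "v x1 < v x0" using \<alpha> by (simp add: v_def)
      then have "\<epsilon> * v x1 < \<epsilon> * v x0" using \<epsilon> by simp
      moreover have "w x1 \<le> M" using le[OF x1X] by (simp add: w_def)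
      ultimately show False using ge by (simp add: \<phi>_def)
    qed
  qed
  then have "dist x0 x1 < r" using x1(1) by (auto simp: less_le)
  define r1 where "r1 = r - dist x0 x1"
  have r1: "r1 > 0" using \<open>dist x0 x1 < r\<close> by (simp add: r1_def)
  have ball: "ball x1 r1 \<subseteq> cball x0 r"
  proof
    fix x assume "x \<in> ball x1 r1"
    then show "x \<in> cball x0 r" using dist_triangle[of x0 x x1] by (simp add: r1_def)
  qed
  let ?A = "hessian_arg k u x1" and ?B = "hessian_arg k H x1" and ?z = "x1 - y"
  define T where "T = \<alpha> *\<^sub>R sym_product ?z ?z - mat 1"
  \<comment> \<open>The Hessian of \<open>\<epsilon> v\<close> at \<open>x1\<close> is \<open>c T\<close>.\<close>
  define c where "c = 2 * \<alpha> * \<epsilon> * v x1"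
  have c: "c > 0" using \<alpha> \<epsilon> by (simp add: c_def v_def)
  have TS: "T \<in> Sym2 UNIV" unfolding T_def
    by (intro subspace_diff[OF subspace_Sym2] subspace_scale[OF subspace_Sym2] sym_product_in_Sym2 mat_1_in_Sym2)
  have quad: "quad_form (?B - c *\<^sub>R T - ?A) \<xi> \<ge> 0" for \<xi>
  proof -
    have "quad_form (hessian u x1 - hessian H x1) \<xi> +
      \<epsilon> * (v x1 * (4 * \<alpha>\<^sup>2 * (?z \<bullet> \<xi>)\<^sup>2 - 2 * \<alpha> * (\<xi> \<bullet> \<xi>))) \<le> 0"
      unfolding v_def
    proof (rule hessian_comparison_at_max[OF C2 _ r1])
      show "ball x1 r1 \<subseteq> X" using ball r(2) by blast
      show "u x' - H x' + \<epsilon> * exp (- \<alpha> * (norm (x' - y))\<^sup>2) \<le> u x1 - H x1 + \<epsilon> * exp (- \<alpha> * (norm (x1 - y))\<^sup>2)"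
        if "x' \<in> ball x1 r1" for x'
        using x1(2)[of x'] ball that by (auto simp: \<phi>_def w_def v_def)
    qed
    moreover have "c * quad_form T \<xi> = \<epsilon> * (v x1 * (4 * \<alpha>\<^sup>2 * (?z \<bullet> \<xi>)\<^sup>2 - 2 * \<alpha> * (\<xi> \<bullet> \<xi>)))"
      by (simp only: T_def c_def quad_form_diff quad_form_scale quad_form_sym_product quad_form_mat_1)
        (simp add: power2_eq_square algebra_simps)
    moreover have "quad_form (hessian u x1 - hessian H x1) \<xi> = quad_form ?A \<xi> - quad_form ?B \<xi>"
      by (metis hessian_arg_diff quad_form_diff)
    ultimately have "quad_form ?B \<xi> - c * quad_form T \<xi> - quad_form ?A \<xi> \<ge> 0" by linarith
    then show ?thesis by (simp only: quad_form_diff quad_form_scale)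
  qed
  have PS: "?B - c *\<^sub>R T - ?A \<in> Sym2 UNIV"
    by (intro subspace_diff[OF subspace_Sym2] subspace_scale[OF subspace_Sym2] TS cone_in A B x1X)
  note P = psd_in_closure_cone[OF PS quad]
  have "?A + (?B - c *\<^sub>R T - ?A) \<in> \<Gamma>" "g ?A \<le> g (?A + (?B - c *\<^sub>R T - ?A))"
    using cone_in_closure_direction[OF A[OF x1X] P PS] by blast+
  then have bwd: "?B - c *\<^sub>R T \<in> \<Gamma>" "g ?A \<le> g (?B - c *\<^sub>R T)" by simp_all
  have "g (?B - c *\<^sub>R T) < g ?B"
    using fwd[OF x1(1)] by (intro strict_decrease_backwards[OF B[OF x1X] TS s c _ _ bwd(1)]) (auto simp: T_def)
  then show False using bwd(2) gAB[OF x1X] by simp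
qed

lemma strong_comparison:
  assumes complete: "complete_operator g" and X: "open X" "connected X"
    and u: "C2_subsolution k g X f u" and H: "C2_solution k g X f H"
    and max: "has_max_in X (\<lambda>x. u x - H x)"
  shows "\<exists>c. \<forall>x\<in>X. u x = H x + c"
proof -
  obtain p where p: "p \<in> X" "\<And>x. x \<in> X \<Longrightarrow> u x - H x \<le> u p - H p"
    using max by (auto simp: has_max_in_def)
  have C2: "C2_on X u" "C2_on X H" using u H by (auto simp: C2_subsolution_def C2_solution_def)
  have A: "hessian_arg k u x \<in> \<Gamma>" if "x \<in> X" for x
    using u that by (intro hessian_arg_in_cone[of _ f x]) (auto simp: C2_subsolution_def)
  have B: "hessian_arg k H x \<in> \<Gamma>" if "x \<in> X" for x
    using H that by (intro hessian_arg_in_cone[of _ f x]) (auto simp: C2_solution_def)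
  have gAB: "g (hessian_arg k H x) \<le> g (hessian_arg k u x)" if "x \<in> X" for x
    using u H that by (simp add: C2_subsolution_def C2_solution_def)
  have "u q - H q = u p - H p" if q: "q \<in> X" for q
  proof (rule ccontr)
    assume neq: "u q - H q \<noteq> u p - H p"
    have cont: "continuous_on X (\<lambda>x. u x - H x)" by (intro continuous_on_diff C2_on_continuous C2)
    show False
    proof (rule tangent_ball_at_maximum[OF X cont p(2) p(1) refl q neq])
      fix x0 y
      assume x0: "x0 \<in> X" "x0 \<noteq> y" "u x0 - H x0 = u p - H p"
        and less: "\<And>x. x \<in> X \<Longrightarrow> dist x y \<le> dist x0 y \<Longrightarrow> x \<noteq> x0 \<Longrightarrow> u x - H x < u p - H p"
      show False
        by (rule no_tangent_ball_at_maximum[OF complete X(1) C2 A B gAB x0 p(2) less])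
    qed
  qed
  then have "\<forall>x\<in>X. u x = H x + (u p - H p)" by (simp add: algebra_simps)
  then show ?thesis by blast
qed

end

theorem theorem4p12:
  fixes g :: "real^'n^'n \<Rightarrow> real" and N :: nat
    and X :: "(real^'n) set" and f :: "real^'n \<Rightarrow> real" and k :: equation_kind
  assumes "garding_dirichlet UNIV N g" and "complete_operator g"
    and "open X" and "connected X" and "continuous_on X f"
  shows "(\<forall>u H. C2_subsolution k g X f u \<and> C2_solution k g X f H \<and>
              has_max_in X (\<lambda>x. u x - H x) \<longrightarrow>
            (\<exists>c. \<forall>x\<in>X. u x = H x + c) \<and> C2_solution k g X f u)
       \<and> (\<forall>H1 H2. C2_solution k g X f H1 \<and> C2_solution k g X f H2 \<and>
              (has_max_in X (\<lambda>x. H1 x - H2 x) \<or> has_min_in X (\<lambda>x. H1 x - H2 x)) \<longrightarrow>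
            (\<exists>c. \<forall>x\<in>X. H1 x = H2 x + c))"
proof -
  interpret dirichlet_garding g N by unfold_locales (rule assms(1))
  note comparison = strong_comparison[OF assms(2,3,4)]
  have sub: "C2_subsolution k g X f H" if "C2_solution k g X f H" for H
    using that by (simp add: C2_subsolution_def C2_solution_def)
  have sol: "C2_solution k g X f u"
    if "C2_subsolution k g X f u" "C2_solution k g X f H" "\<And>x. x \<in> X \<Longrightarrow> u x = H x + c" for u H c
    using that(1) by (intro C2_solution_add_constant[OF assms(3) that(2) _ that(3)])
      (simp add: C2_subsolution_def)
  show ?thesis
  proof (intro conjI allI impI; elim conjE)
    fix u H
    assume u: "C2_subsolution k g X f u" and H: "C2_solution k g X f H"
      and "has_max_in X (\<lambda>x. u x - H x)"
    then obtain c where c: "\<forall>x\<in>X. u x = H x + c" using comparison by blast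
    then show "\<exists>c. \<forall>x\<in>X. u x = H x + c" by blast
    show "C2_solution k g X f u" using c by (intro sol[OF u H, of c]) blast
  next
    fix H1 H2
    assume H: "C2_solution k g X f H1" "C2_solution k g X f H2"
      and "has_max_in X (\<lambda>x. H1 x - H2 x) \<or> has_min_in X (\<lambda>x. H1 x - H2 x)"
    then consider "has_max_in X (\<lambda>x. H1 x - H2 x)" | "has_min_in X (\<lambda>x. H1 x - H2 x)" by blast
    then show "\<exists>c. \<forall>x\<in>X. H1 x = H2 x + c"
    proof cases
      case 1
      then show ?thesis by (rule comparison[OF sub[OF H(1)] H(2)])
    next
      case 2
      then obtain p where p: "p \<in> X" "\<And>x. x \<in> X \<Longrightarrow> H1 p - H2 p \<le> H1 x - H2 x"
        by (auto simp: has_min_in_def)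
      have "H2 x - H1 x \<le> H2 p - H1 p" if "x \<in> X" for x using p(2)[OF that] by linarith
      then have "has_max_in X (\<lambda>x. H2 x - H1 x)" unfolding has_max_in_def using p(1) by blast
      then obtain c where c: "\<forall>x\<in>X. H2 x = H1 x + c"
        using comparison[OF sub[OF H(2)] H(1)] by blast
      then have "\<forall>x\<in>X. H1 x = H2 x + (- c)" by simp
      then show ?thesis by blast
    qed
  qed
qed

end
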